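(* Let $p \ge 5$ be an odd prime. Then $a'(K_{p^2,p^2}) = p^2+2 = \Delta+2$, where $\Delta = p^2$ is the maximum degree of $K_{p^2,p^2}$.
   Context: For a finite simple graph $G$, a proper edge-coloring assigns colors to edges so that adjacent edges receive different colors. An acyclic edge-coloring is a proper edge-coloring with no bichromatic (2-colored) cycle. The acyclic chromatic index $a'(G)$ is the least integer $k$ such that $G$ admits an acyclic edge-coloring using $k$ colors. $K_{n,n}$ denotes the complete bipartite graph with $n$ vertices on each side. *)

theory Defs
  imports "HOL-Computational_Algebra.Primes" "Graph_Theory.Kuratowski"
begin

text \<open>A finite simple graph is a \<^const>\<open>graph\<close>, that is, a symmetric loop-free digraph without
  multiple arcs. An undirected edge is a pair of opposite arcs, represented by its set of ends;
  colorings are defined on these sets, so opposite arcs share their color by construction.\<close>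

definition edge_of :: "('a, 'b) pre_digraph \<Rightarrow> 'b \<Rightarrow> 'a set" where
  "edge_of G a = {tail G a, head G a}"

definition edges :: "('a, 'b) pre_digraph \<Rightarrow> 'a set set" where
  "edges G = edge_of G ` arcs G"

definition vertex_degree :: "('a, 'b) pre_digraph \<Rightarrow> 'a \<Rightarrow> nat" where
  "vertex_degree G v = card {e \<in> edges G. v \<in> e}"

definition max_degree :: "('a, 'b) pre_digraph \<Rightarrow> nat" where
  "max_degree G = Max (vertex_degree G ` verts G)"

text \<open>\<^const>\<open>pre_digraph.cycle\<close> also admits the directed 2-cycle traversing an edge back and forth,
  which is not a cycle of the undirected graph. Length at least 3 excludes exactly these.\<close>

definition undirected_cycle :: "('a, 'b) pre_digraph \<Rightarrow> 'b list \<Rightarrow> bool" where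
  "undirected_cycle G w \<longleftrightarrow> pre_digraph.cycle G w \<and> 3 \<le> length w"

definition proper_edge_coloring :: "('a, 'b) pre_digraph \<Rightarrow> ('a set \<Rightarrow> 'c) \<Rightarrow> bool" where
  "proper_edge_coloring G c \<longleftrightarrow>
     (\<forall>e \<in> edges G. \<forall>f \<in> edges G. e \<noteq> f \<and> e \<inter> f \<noteq> {} \<longrightarrow> c e \<noteq> c f)"

definition bichromatic :: "('a, 'b) pre_digraph \<Rightarrow> ('a set \<Rightarrow> 'c) \<Rightarrow> 'b list \<Rightarrow> bool" where
  "bichromatic G c w \<longleftrightarrow> card (c ` edge_of G ` set w) = 2"

definition acyclic_edge_coloring :: "('a, 'b) pre_digraph \<Rightarrow> ('a set \<Rightarrow> 'c) \<Rightarrow> bool" where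
  "acyclic_edge_coloring G c \<longleftrightarrow>
     proper_edge_coloring G c \<and> \<not> (\<exists>w. undirected_cycle G w \<and> bichromatic G c w)"

definition acyclic_edge_colorable :: "('a, 'b) pre_digraph \<Rightarrow> nat \<Rightarrow> bool" where
  "acyclic_edge_colorable G k \<longleftrightarrow>
     (\<exists>c :: 'a set \<Rightarrow> nat. c ` edges G \<subseteq> {..<k} \<and> acyclic_edge_coloring G c)"

definition acyclic_chromatic_index :: "('a, 'b) pre_digraph \<Rightarrow> nat" where
  "acyclic_chromatic_index G = (LEAST k. acyclic_edge_colorable G k)"

text \<open>Coloring all edges differently shows that the minimum is attained for every graph.\<close>

lemma card_edges_undirected_cycle:
  assumes "graph G" "undirected_cycle G w"
  shows "3 \<le> card (edge_of G ` set w)"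
proof -
  interpret graph G by fact
  obtain u where u: "awalk u w u" "distinct (tl (awalk_verts u w))"
    using assms(2) unfolding undirected_cycle_def cycle_def by blast
  obtain a b c r where w: "w = a # b # c # r"
    using assms(2) unfolding undirected_cycle_def
    by (metis Suc_le_length_iff numeral_3_eq_3)
  have "cas u w u" using u(1) by (simp add: awalk_def)
  then have eq: "tail G a = u" "tail G b = head G a" "tail G c = head G b"
    and r: "cas (head G c) r u"
    by (simp_all add: w)
  have "u = last (awalk_verts (head G c) r)" using r by (simp add: awlast_if_cas)
  moreover have "awalk_verts x q \<noteq> []" for x q by (cases q) simp_all
  ultimately have "u \<in> set (awalk_verts (head G c) r)" by (metis last_in_set)
  moreover have "head G c \<in> set (awalk_verts (head G c) r)"
    using r by (cases r) simp_all
  moreover have "distinct (head G a # head G b # awalk_verts (head G c) r)"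
    using u(2) eq by (simp add: w)
  ultimately have "u \<noteq> head G a" "u \<noteq> head G b" "head G a \<noteq> head G b"
    "head G c \<noteq> head G a" "head G c \<noteq> head G b" by auto
  then have "card {edge_of G a, edge_of G b, edge_of G c} = 3"
    by (auto simp: edge_of_def eq doubleton_eq_iff card_insert_if)
  moreover have "{edge_of G a, edge_of G b, edge_of G c} \<subseteq> edge_of G ` set w"
    by (auto simp: w)
  ultimately show ?thesis by (metis card_mono finite_imageI finite_set)
qed

lemma acyclic_edge_colorable_acyclic_chromatic_index:
  assumes "graph G"
  shows "acyclic_edge_colorable G (acyclic_chromatic_index G)"
proof -
  interpret graph G by fact
  have "finite (edges G)" by (simp add: edges_def)
  then obtain c :: "'a set \<Rightarrow> nat" where c: "c ` edges G = {..<card (edges G)}" "inj_on c (edges G)"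
    using ex_bij_betw_finite_nat[of "edges G"] by (auto simp: bij_betw_def atLeast0LessThan)
  have "\<not> bichromatic G c w" if w: "undirected_cycle G w" for w
  proof -
    have "set w \<subseteq> arcs G"
      using w by (auto simp: undirected_cycle_def cycle_def)
    then have "inj_on c (edge_of G ` set w)"
      by (intro inj_on_subset[OF c(2)]) (auto simp: edges_def)
    then show ?thesis
      using card_edges_undirected_cycle[OF assms w] by (simp add: bichromatic_def card_image)
  qed
  then have "acyclic_edge_colorable G (card (edges G))"
    using c unfolding acyclic_edge_colorable_def acyclic_edge_coloring_def proper_edge_coloring_def
    by (intro exI[of _ c]) (auto dest: inj_onD)
  then show ?thesis unfolding acyclic_chromatic_index_def by (rule LeastI)
qed

end

theory Submission
  imports Defs "HOL-Number_Theory.Residue_Primitive_Roots"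
begin

text \<open>
  Lower bound. Let \<open>n = p\<^sup>2\<close>, which is odd. At most one color class of an acyclic coloring is a perfect
  matching, so with \<open>n + 1\<close> colors exactly one class is perfect and all others miss one vertex on each
  side. Completing each class by the edge between its missed vertices gives permutations that are
  \<open>n\<close>-cycles relative to the perfect class, hence even. The color of such a completing edge yields
  a quotient of two of them that is a cycle of even length \<open>n - 1\<close>, hence odd.

  Upper bound. On pairs of integers modulo \<open>p\<close> there is a perfect 1-factorization of the graph, built
  from a primitive root \<open>g\<close>; away from two lines its factors are the translations. Two matchings are
  recolored with two new colors. Together they meet every factor, so no Hamiltonian cycle formed by two
  factors survives, and each of them is chosen such that it forms no cycle with any translation.
\<close>

text \<open>Two disjoint perfect matchings form a 2-regular graph, so two full color classes always
  close a cycle.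

  The translations of the plane modulo \<open>p\<close> already form a 1-factorization, but two of
  them close into \<open>p\<close> cycles of length \<open>2 * p\<close>. The corrections on the
  lines x = 0 and v = 0 splice these into one cycle. To break all such cycles, every factor but at
  most one has to lose an edge, and by the lower bound one new color cannot achieve this.

  An affine permutation of the whole plane would close cycles with a factor even after their shared
  edges are recolored, so the affine matching leaves lines uncovered at which alternating paths end.
  One line would be too little: an orbit may run through all first coordinates but one. Of two lines
  it meets at least one. The price is the \<open>2 * p\<close> factors whose common edge with the
  affine map starts on these lines; they are left to the second matching. Its two parameters are
  tied by one relation and have to avoid three residues, which leaves a choice because
  \<open>p\<close> exceeds 3.\<close>

text \<open>
  The sets \<open>S\<close> and \<open>f ` S = h ` S\<close>
  are the two sides of a disjoint union of cycles in the colors \<open>a\<close> and \<open>b\<close>.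
\<close>

definition acyclic_array :: "'x set \<Rightarrow> 'y set \<Rightarrow> ('x \<Rightarrow> 'y \<Rightarrow> 'c) \<Rightarrow> bool" where
  "acyclic_array X Y C \<longleftrightarrow>
     (\<forall>x\<in>X. inj_on (C x) Y) \<and> (\<forall>y\<in>Y. inj_on (\<lambda>x. C x y) X) \<and>
     (\<forall>S f h a b. S \<subseteq> X \<and> S \<noteq> {} \<and> f ` S \<subseteq> Y \<and> h ` S = f ` S \<and> a \<noteq> b \<longrightarrow>
        \<not> (\<forall>x\<in>S. C x (f x) = a \<and> C x (h x) = b))"

lemma acyclic_arrayI:
  assumes "\<And>x. x \<in> X \<Longrightarrow> inj_on (C x) Y" "\<And>y. y \<in> Y \<Longrightarrow> inj_on (\<lambda>x. C x y) X"
    and "\<And>S f h a b. S \<subseteq> X \<Longrightarrow> S \<noteq> {} \<Longrightarrow> f ` S \<subseteq> Y \<Longrightarrow> h ` S = f ` S \<Longrightarrow>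
      (\<And>x. x \<in> S \<Longrightarrow> C x (f x) = a) \<Longrightarrow> (\<And>x. x \<in> S \<Longrightarrow> C x (h x) = b) \<Longrightarrow> a = b"
  shows "acyclic_array X Y C"
  unfolding acyclic_array_def
proof (intro conjI ballI allI impI notI assms(1,2))
  fix S f h a b
  assume "S \<subseteq> X \<and> S \<noteq> {} \<and> f ` S \<subseteq> Y \<and> h ` S = f ` S \<and> a \<noteq> b"
    and "\<forall>x\<in>S. C x (f x) = a \<and> C x (h x) = b"
  then show False using assms(3)[of S f h a b] by simp
qed

lemma acyclic_arrayD:
  assumes "acyclic_array X Y C" "S \<subseteq> X" "S \<noteq> {}" "f ` S \<subseteq> Y" "h ` S = f ` S"
    and "\<And>x. x \<in> S \<Longrightarrow> C x (f x) = a" "\<And>x. x \<in> S \<Longrightarrow> C x (h x) = b"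
  shows "a = b"
  using assms unfolding acyclic_array_def by meson

subsection \<open>The lower bound\<close>

text \<open>The last assumption says that the orbit of \<open>l\<close> is all of \<open>A\<close>,
  in the form in which acyclicity delivers it. Multiplying by the transposition of \<open>l\<close>
  and \<open>\<pi> l\<close> takes \<open>l\<close> out of the cycle, reverses the sign and leaves a
  cycle through \<open>\<pi> l\<close> on \<open>A - {l}\<close>.\<close>

lemma sign_single_cycle:
  assumes "finite A" "\<pi> permutes A" "l \<in> A"
    and "\<And>S. S \<subseteq> A \<Longrightarrow> S \<noteq> {} \<Longrightarrow> \<pi> ` S = S \<Longrightarrow> l \<in> S"
  shows "sign \<pi> = (- 1) ^ (card A - 1)"
  using assms
proof (induction "card A" arbitrary: A \<pi> l rule: less_induct)
  case less
  note fin = less.prems(1) and perm = less.prems(2) and l = less.prems(3) and cyc = less.prems(4)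
  show ?case
  proof (cases "\<pi> l = l")
    case True
    have "\<pi> ` (A - {l}) = A - {l}"
      using True permutes_image[OF perm] permutes_inj[OF perm]
      by (metis image_insert image_is_empty image_set_diff)
    then have A: "A = {l}" using cyc[of "A - {l}"] l by blast
    then have "\<pi> = id" using perm by simp
    then show ?thesis using A by simp
  next
    case False
    define m where "m = \<pi> l"
    define \<pi>' where "\<pi>' = transpose l m \<circ> \<pi>"
    have m: "m \<in> A" "m \<noteq> l" using False l permutes_in_image[OF perm] by (auto simp: m_def)
    have p': "\<pi>' permutes A"
      unfolding \<pi>'_def using m l by (intro permutes_compose[OF perm] permutes_swap_id)
    have fixl: "\<pi>' l = l" by (simp add: \<pi>'_def m_def)
    have p'': "\<pi>' permutes (A - {l})"
      by (rule permutes_superset[OF p']) (use fixl in auto)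
    have "sign \<pi>' = (- 1) ^ (card (A - {l}) - 1)"
    proof (rule less.hyps[OF _ _ p''])
      show "card (A - {l}) < card A" using fin l by (rule card_Diff1_less)
      show "finite (A - {l})" using fin by simp
      show "m \<in> A - {l}" using m by simp
    next
      fix S assume S: "S \<subseteq> A - {l}" "S \<noteq> {}" "\<pi>' ` S = S"
      show "m \<in> S"
      proof (rule ccontr)
        assume "m \<notin> S"
        \<comment> \<open>The transposition moves only \<open>l\<close> and \<open>m\<close>, and
          \<open>S\<close> contains neither.\<close>
        have "\<pi> x = \<pi>' x" if "x \<in> S" for x
        proof -
          have "\<pi>' x \<in> S" using S that by blast
          then have "\<pi>' x \<noteq> l" "\<pi>' x \<noteq> m" using S \<open>m \<notin> S\<close> by auto
          then show ?thesis unfolding \<pi>'_def by (auto simp: transpose_def split: if_splits)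
        qed
        then have "\<pi> ` S = S" using S(3) by (metis image_cong)
        then show False using cyc[of S] S by blast
      qed
    qed
    moreover have "sign \<pi>' = - sign \<pi>"
    proof -
      have "permutation \<pi>" using perm fin by (auto simp: permutation_permutes)
      then show ?thesis
        unfolding \<pi>'_def using m by (simp add: sign_compose sign_swap_id permutation_swap_id)
    qed
    moreover have "card A - 1 = Suc (card A - 2)"
      using card_mono[of A "{l, m}"] fin l m by simp
    ultimately show ?thesis using fin l by (simp add: numeral_2_eq_2)
  qed
qed

text \<open>Oddness of \<open>n\<close> enters twice: a cycle on \<open>n\<close> points is even and
  one on \<open>n - 1\<close> points is odd. For even \<open>n\<close> the same signs would be
  consistent.\<close>

lemma not_acyclic_array_Suc_colors:
  fixes C :: "'x \<Rightarrow> 'y \<Rightarrow> nat"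
  assumes fin: "finite X" "finite Y" and card: "card X = n" "card Y = n" and n: "odd n" "1 < n"
    and col: "\<And>x y. x \<in> X \<Longrightarrow> y \<in> Y \<Longrightarrow> C x y \<le> n"
  shows "\<not> acyclic_array X Y C"
proof
  assume ac: "acyclic_array X Y C"
  have inj1: "y = y'" if "C x y = C x y'" "x \<in> X" "y \<in> Y" "y' \<in> Y" for x y y'
    using ac that unfolding acyclic_array_def by (meson inj_onD)
  have inj2: "x = x'" if "C x y = C x' y" "x \<in> X" "x' \<in> X" "y \<in> Y" for x x' y
    using ac that unfolding acyclic_array_def by (metis (mono_tags, lifting) inj_onD)
  define E where "E a = {e \<in> X \<times> Y. C (fst e) (snd e) = a}" for a
  define D where "D a = fst ` E a" for a
  define R where "R a = snd ` E a" for a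
  have cD: "card (D a) = card (E a)" for a
    unfolding D_def
    by (intro card_image inj_onI) (clarsimp simp: E_def, metis inj1)
  have cR: "card (R a) = card (E a)" for a
    unfolding R_def
    by (intro card_image inj_onI) (clarsimp simp: E_def, metis inj2)
  have DX: "D a \<subseteq> X" and RY: "R a \<subseteq> Y" for a by (auto simp: D_def R_def E_def)
  define \<nu> where "\<nu> a x = (SOME y. y \<in> Y \<and> C x y = a)" for a x
  have \<nu>: "\<nu> a x \<in> Y" "C x (\<nu> a x) = a" if "x \<in> D a" for a x
  proof -
    have "\<exists>y. y \<in> Y \<and> C x y = a" using that by (auto simp: D_def E_def)
    then show "\<nu> a x \<in> Y" "C x (\<nu> a x) = a"
      unfolding \<nu>_def by (metis (mono_tags, lifting) someI_ex)+
  qed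
  have \<nu>R: "\<nu> a x \<in> R a" if "x \<in> D a" for a x
    using \<nu>[OF that] that DX[of a] by (force simp: R_def E_def)
  have \<nu>inj: "inj_on (\<nu> a) (D a)" for a
    by (intro inj_onI) (metis \<nu> inj2 DX subsetD)
  have noS: False if "a \<noteq> b" "S \<subseteq> D a" "S \<subseteq> D b" "S \<noteq> {}" "\<nu> a ` S = \<nu> b ` S" for a b S
  proof -
    have "S \<subseteq> X" using that DX by blast
    moreover have "\<nu> b ` S \<subseteq> Y" "\<forall>x\<in>S. C x (\<nu> b x) = b \<and> C x (\<nu> a x) = a"
      using \<nu> that by blast+
    ultimately show False using ac that unfolding acyclic_array_def by metis
  qed
  have \<nu>D: "\<nu> a ` D a = R a" for a
    using \<nu>R \<nu>inj[of a] cD[of a] cR[of a] RY[of a] fin(2)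
    by (metis card_image card_subset_eq finite_subset image_subsetI)
  have full_unique: "a = b" if "card (E a) = n" "card (E b) = n" for a b
  proof (rule ccontr)
    assume "a \<noteq> b"
    have "D a = X" "D b = X" "R a = Y" "R b = Y"
      using that cD cR DX RY card fin by (metis card_subset_eq)+
    moreover have "X \<noteq> {}" using card n by auto
    ultimately show False using noS[OF \<open>a \<noteq> b\<close>, of X] \<nu>D[of a] \<nu>D[of b] by auto
  qed
  have le_n: "card (E a) \<le> n" for a
    using cD[of a] card_mono[OF fin(1) DX[of a]] card by simp
  have total: "(\<Sum>a\<le>n. card (E a)) = n * n"
  proof -
    have "X \<times> Y = (\<Union>a\<in>{..n}. E a)" using col by (auto simp: E_def)
    moreover have "card (\<Union>a\<in>{..n}. E a) = (\<Sum>a\<in>{..n}. card (E a))"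
      using fin by (intro card_UN_disjoint) (auto simp: E_def)
    ultimately have "card (X \<times> Y) = (\<Sum>a\<le>n. card (E a))" by simp
    then show ?thesis using card by (simp add: card_cartesian_product)
  qed
  obtain z where z: "z \<le> n" "card (E z) = n"
  proof (rule ccontr)
    assume "\<not> thesis"
    then have "card (E a) \<le> n - 1" if "a \<le> n" for a
      using le_n[of a] that \<open>\<And>z. \<lbrakk>z \<le> n; card (E z) = n\<rbrakk> \<Longrightarrow> thesis\<close> by fastforce
    then have "(\<Sum>a\<le>n. card (E a)) \<le> (n + 1) * (n - 1)"
      using sum_bounded_above[of "{..n}" "\<lambda>a. card (E a)" "n - 1"] by simp
    moreover have "(n + 1) * (n - 1) < n * n" using n(2) by (cases n) auto
    ultimately show False using total by simp
  qed
  \<comment> \<open>One class of \<open>n\<close> edges and \<open>n\<close> classes of at most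
    \<open>n - 1\<close> edges have at most \<open>n * n\<close> edges together, so all bounds are
    attained.\<close>
  have almost: "card (E a) = n - 1" if "a \<le> n" "a \<noteq> z" for a
  proof -
    have le: "card (E b) \<le> n - 1" if "b \<in> {..n} - {z}" for b
      using that le_n[of b] full_unique[of b z] z by fastforce
    have "(\<Sum>b\<in>{..n} - {z}. card (E b)) = n * n - n"
      using total z by (simp add: sum_diff1_nat)
    also have "\<dots> = (\<Sum>b\<in>{..n} - {z}. n - 1)" using z by (simp add: algebra_simps)
    finally have "(\<Sum>b\<in>{..n} - {z}. card (E b)) = (\<Sum>b\<in>{..n} - {z}. n - 1)" .
    then show ?thesis
      using sum_mono_inv[of "\<lambda>b. card (E b)" "{..n} - {z}" "\<lambda>_. n - 1" a] le that by simp
  qed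
  have "\<exists>l r. X - D a = {l} \<and> Y - R a = {r}" if "a \<le> n" "a \<noteq> z" for a
  proof -
    have "card (X - D a) = 1" "card (Y - R a) = 1"
      using almost[OF that] cD[of a] cR[of a] DX[of a] RY[of a] fin card n
      by (simp_all add: card_Diff_subset finite_subset)
    then show ?thesis by (metis card_1_singletonE)
  qed
  then obtain l r where lr: "X - D a = {l a}" "Y - R a = {r a}" if "a \<le> n" "a \<noteq> z" for a
    by metis
  \<comment> \<open>\<open>r a\<close> is specified only for \<open>a \<noteq> z\<close>; for
    \<open>z\<close> the second branch is never taken on \<open>X\<close>, because
    \<open>D z\<close> is all of \<open>X\<close>.\<close>
  define \<sigma> where "\<sigma> a x = (if x \<in> D a then \<nu> a x else r a)" for a x
  have \<sigma>: "bij_betw (\<sigma> a) X Y" if "a \<le> n" for a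
  proof -
    have "bij_betw (\<sigma> a) (D a) (R a)"
      using \<nu>D[of a] \<nu>inj[of a] by (simp add: bij_betw_def \<sigma>_def cong: inj_on_cong)
    moreover have "bij_betw (\<sigma> a) (X - D a) (Y - R a)"
    proof (cases "a = z")
      case True
      then have "D a = X" "R a = Y"
        using z cD[of z] cR[of z] DX[of z] RY[of z] fin card by (metis card_subset_eq)+
      then show ?thesis by (simp add: bij_betw_def)
    next
      case False
      then have "l a \<notin> D a" "X - D a = {l a}" "Y - R a = {r a}" using lr[of a] that by auto
      then show ?thesis by (simp add: bij_betw_def \<sigma>_def)
    qed
    moreover have "R a \<inter> (Y - R a) = {}" by blast
    ultimately have "bij_betw (\<sigma> a) (D a \<union> (X - D a)) (R a \<union> (Y - R a))"
      by (rule bij_betw_combine)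
    then show ?thesis using DX[of a] RY[of a] by (simp add: Un_absorb1)
  qed
  define \<rho> where "\<rho> b a x = (if x \<in> X then inv_into X (\<sigma> b) (\<sigma> a x) else x)" for b a x
  have \<rho>: "\<rho> b a permutes X" "\<And>x. x \<in> X \<Longrightarrow> \<sigma> b (\<rho> b a x) = \<sigma> a x"
    if "a \<le> n" "b \<le> n" for a b
  proof -
    have "bij_betw (inv_into X (\<sigma> b) \<circ> \<sigma> a) X X"
      using \<sigma>[OF that(1)] bij_betw_inv_into[OF \<sigma>[OF that(2)]] by (rule bij_betw_trans)
    then have "bij_betw (\<rho> b a) X X" by (simp add: \<rho>_def cong: bij_betw_cong)
    then show "\<rho> b a permutes X" by (rule bij_imp_permutes) (simp add: \<rho>_def)
    show "\<sigma> b (\<rho> b a x) = \<sigma> a x" if "x \<in> X" for x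
      using that \<sigma>[OF \<open>a \<le> n\<close>] \<sigma>[OF \<open>b \<le> n\<close>]
      by (auto simp: \<rho>_def bij_betw_def intro!: f_inv_into_f)
  qed
  \<comment> \<open>Where neither class misses a point, the completed classes are the colors
    themselves, so an invariant set there would be a union of bichromatic cycles. Every nonempty
    invariant set therefore contains a missed point.\<close>
  have noI: False
    if "a \<le> n" "b \<le> n" "a \<noteq> b" "S \<subseteq> D a" "S \<subseteq> D b" "S \<noteq> {}" "\<rho> b a ` S = S" for a b S
  proof (rule noS[OF that(3-6)])
    have "\<nu> a ` S = \<sigma> a ` S" using that by (intro image_cong) (auto simp: \<sigma>_def)
    also have "\<dots> = \<sigma> b ` \<rho> b a ` S"
      unfolding image_image using \<rho>(2)[of a b] that DX[of a] by (intro image_cong) auto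
    also have "\<dots> = \<nu> b ` S" unfolding that(7)
      using that by (intro image_cong) (auto simp: \<sigma>_def)
    finally show "\<nu> a ` S = \<nu> b ` S" .
  qed
  have Dz: "D z = X" using z cD[of z] DX[of z] card fin by (simp add: card_subset_eq)
  have inD: "S \<subseteq> D a" if "a \<le> n" "a \<noteq> z" "S \<subseteq> X" "l a \<notin> S" for a S
    using lr(1)[OF that(1,2)] that(3,4) by (metis DiffI singletonD subsetD subsetI)
  have lX: "l a \<in> X" "l a \<notin> D a" if "a \<le> n" "a \<noteq> z" for a
    using lr(1)[OF that] by auto
  have even_\<rho>: "sign (\<rho> z a) = 1" if "a \<le> n" "a \<noteq> z" for a
  proof -
    have "sign (\<rho> z a) = (- 1) ^ (card X - 1)"
    proof (rule sign_single_cycle[OF fin(1) \<rho>(1)[OF that(1) z(1)] lX(1)[OF that]])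
      fix S assume "S \<subseteq> X" "S \<noteq> {}" "\<rho> z a ` S = S"
      then show "l a \<in> S" using noI[of a z S] inD[of a S] that z Dz by blast
    qed
    then show ?thesis using card n by simp
  qed
  txt \<open>The edge \<open>(l a, r a)\<close> has a color \<open>b\<close> different from \<open>a\<close>. Then \<open>\<rho> b a\<close> fixes \<open>l a\<close> and is a
    single cycle on the other \<open>n - 1\<close> points, so it is odd, but it is a quotient of even permutations.\<close>
  define a :: nat where "a = (if z = 0 then 1 else 0)"
  have a: "a \<le> n" "a \<noteq> z" using n by (auto simp: a_def)
  define b where "b = C (l a) (r a)"
  have rY: "r a \<in> Y" using lr(2)[OF a] by blast
  have b: "b \<le> n" unfolding b_def using col lX(1)[OF a] rY by blast
  have lDb: "l a \<in> D b" unfolding D_def E_def b_def using lX(1)[OF a] rY by force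
  then have ba: "b \<noteq> a" using lX(2)[OF a] by auto
  have "\<nu> b (l a) = r a"
    using \<nu>[OF lDb] inj1[of "l a" "\<nu> b (l a)" "r a"] lX(1)[OF a] rY by (simp add: b_def)
  then have "\<sigma> b (l a) = \<sigma> a (l a)" using lDb lX(2)[OF a] by (simp add: \<sigma>_def)
  then have fixl: "\<rho> b a (l a) = l a"
    using lX(1)[OF a] \<sigma>[OF b] unfolding \<rho>_def by (metis bij_betw_inv_into_left)
  have p: "\<rho> b a permutes (X - {l a})"
    by (rule permutes_superset[OF \<rho>(1)[OF a(1) b]]) (use fixl in auto)
  \<comment> \<open>With color \<open>z\<close> on the completing edge, \<open>X - {l a}\<close>
    would be invariant under \<open>\<rho> z a\<close>, although neither class misses a point of
    it.\<close>
  have bz: "b \<noteq> z"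
  proof
    assume "b = z"
    have "X - {l a} \<noteq> {}" using card n card_mono[of "{l a}" X] by auto
    moreover have "\<rho> z a ` (X - {l a}) = X - {l a}" using p \<open>b = z\<close> by (metis permutes_image)
    ultimately show False using noI[of a z "X - {l a}"] inD[of a "X - {l a}"] a z Dz by blast
  qed
  \<comment> \<open>Color \<open>a\<close> misses only \<open>l a\<close>, so inside
    \<open>X - {l a}\<close> the missed point of an invariant set has to be
    \<open>l b\<close>.\<close>
  have "sign (\<rho> b a) = (- 1) ^ (card (X - {l a}) - 1)"
  proof (rule sign_single_cycle[OF _ p])
    show "finite (X - {l a})" using fin by simp
    show "l b \<in> X - {l a}" using lX[OF b bz] lDb by auto
  next
    fix S assume S: "S \<subseteq> X - {l a}" "S \<noteq> {}" "\<rho> b a ` S = S"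
    show "l b \<in> S"
    proof (rule ccontr)
      assume "l b \<notin> S"
      then show False
        using noI[of a b S] inD[of a S] inD[of b S] S a b bz ba by blast
    qed
  qed
  also have "\<dots> = - 1"
  proof -
    have "card (X - {l a}) - 1 = n - 2" using lX(1)[OF a] card fin by simp
    then show ?thesis using n by auto
  qed
  finally have odd: "sign (\<rho> b a) = - 1" .
  have "\<rho> z a = \<rho> z b \<circ> \<rho> b a"
  proof
    fix x
    show "\<rho> z a x = (\<rho> z b \<circ> \<rho> b a) x"
    proof (cases "x \<in> X")
      case True
      then have "\<rho> b a x \<in> X" using permutes_in_image[OF \<rho>(1)[OF a(1) b]] by blast
      then show ?thesis using True \<rho>(2)[OF a(1) b True] by (simp add: \<rho>_def)
    next
      case False
      then show ?thesis by (simp add: \<rho>_def)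
    qed
  qed
  moreover have "permutation (\<rho> z b)" "permutation (\<rho> b a)"
    using \<rho>(1) a b z fin by (auto simp: permutation_permutes)
  ultimately have "sign (\<rho> z a) = sign (\<rho> z b) * sign (\<rho> b a)" by (simp add: sign_compose)
  then show False using odd even_\<rho>[OF a] even_\<rho>[OF b bz] by simp
qed

subsection \<open>Arrays and edge colorings\<close>

locale complete_bipartite = graph G for G :: "('a, 'b) pre_digraph" +
  fixes U V :: "'a set"
  assumes verts_eq: "verts G = U \<union> V" and disj: "U \<inter> V = {}"
    and ends_eq: "arcs_ends G = U \<times> V \<union> V \<times> U"
begin

lemma ex_arc_iff: "(\<exists>e\<in>arcs G. tail G e = x \<and> head G e = y) \<longleftrightarrow> (x, y) \<in> U \<times> V \<union> V \<times> U"
  unfolding ends_eq[symmetric] arcs_ends_def arc_to_ends_def by force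

lemma edge_iff: "{x, y} \<in> edges G \<longleftrightarrow> (x, y) \<in> U \<times> V \<union> V \<times> U"
proof -
  have "{x, y} \<in> edges G \<longleftrightarrow> (\<exists>e\<in>arcs G. tail G e = x \<and> head G e = y)
      \<or> (\<exists>e\<in>arcs G. tail G e = y \<and> head G e = x)"
    unfolding edges_def edge_of_def by (auto simp: doubleton_eq_iff image_iff)
  then show ?thesis unfolding ex_arc_iff by auto
qed

lemma edges_eq: "edges G = {{u, v} |u v. u \<in> U \<and> v \<in> V}"
proof
  show "{{u, v} |u v. u \<in> U \<and> v \<in> V} \<subseteq> edges G" using edge_iff by blast
  show "edges G \<subseteq> {{u, v} |u v. u \<in> U \<and> v \<in> V}"
  proof
    fix e assume "e \<in> edges G"
    then obtain x y where e: "e = {x, y}" unfolding edges_def edge_of_def by blast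
    with \<open>e \<in> edges G\<close> have "(x, y) \<in> U \<times> V \<union> V \<times> U" using edge_iff by blast
    then show "e \<in> {{u, v} |u v. u \<in> U \<and> v \<in> V}" using e by (auto simp: insert_commute)
  qed
qed

text \<open>As a sequence over all natural numbers that is injective modulo its period, the cycle
  needs no special treatment of its closing arc.\<close>

lemma undirected_cycleD:
  assumes "undirected_cycle G w"
  obtains t :: "nat \<Rightarrow> 'a" and N where "3 \<le> N" "\<And>i j. t i = t j \<longleftrightarrow> i mod N = j mod N"
    "edge_of G ` set w = range (\<lambda>k. {t k, t (Suc k)})"
proof -
  define N where "N = length w"
  have N: "3 \<le> N" using assms by (simp add: undirected_cycle_def N_def)
  then have ne: "w \<noteq> []" by (auto simp: N_def)
  obtain u where u: "awalk u w u" "distinct (tl (awalk_verts u w))"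
    using assms unfolding undirected_cycle_def cycle_def by blast
  have cas: "cas u w u" using u(1) by (simp add: awalk_def)
  have conv: "awalk_verts u w = map (tail G) w @ [head G (last w)]"
    "awalk_verts u w = tail G (hd w) # map (head G) w"
    using ne by (simp add: awalk_verts_conv) (use ne awalk_verts_conv'[OF cas] in simp)
  have ends: "tail G (hd w) = u" "head G (last w) = u"
    using cas_simp[OF ne] cas awlast_if_cas[OF cas] conv(1) by auto
  have dist: "distinct (map (head G) w)" using u(2) conv(2) by simp
  define t where "t k = head G (w ! (k mod N))" for k
  have lt: "k mod N < length w" for k using N mod_less_divisor[of N k] unfolding N_def by linarith
  have inj: "t i = t j \<longleftrightarrow> i mod N = j mod N" for i j
    unfolding t_def using nth_eq_iff_index_eq[OF dist, of "i mod N" "j mod N"] lt by simp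
  have tl: "tail G (w ! (Suc k mod N)) = t k" for k
  proof (cases "Suc (k mod N) = N")
    case True
    then have "w ! (k mod N) = last w" using ne by (metis N_def diff_Suc_1 last_conv_nth)
    moreover have "Suc k mod N = 0" using True by (simp add: mod_Suc)
    ultimately show ?thesis using ends ne by (simp add: t_def hd_conv_nth)
  next
    case False
    then have S: "Suc k mod N = Suc (k mod N)" by (simp add: mod_Suc)
    have "(map (tail G) w @ [head G (last w)]) ! Suc (k mod N) = (tail G (hd w) # map (head G) w) ! Suc (k mod N)"
      using conv by simp
    then show ?thesis using lt[of k] lt[of "Suc k"] S by (simp add: nth_append t_def)
  qed
  have e: "edge_of G (w ! (Suc k mod N)) = {t k, t (Suc k)}" for k
    unfolding edge_of_def tl by (simp add: t_def)
  have "edge_of G ` set w = range (\<lambda>k. {t k, t (Suc k)})"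
  proof
    show "range (\<lambda>k. {t k, t (Suc k)}) \<subseteq> edge_of G ` set w"
      using e lt nth_mem by (metis (no_types, lifting) image_eqI image_subsetI)
    show "edge_of G ` set w \<subseteq> range (\<lambda>k. {t k, t (Suc k)})"
    proof
      fix x assume "x \<in> edge_of G ` set w"
      then obtain i where i: "i < N" "x = edge_of G (w ! i)" by (auto simp: in_set_conv_nth N_def)
      then have "Suc (i + N - 1) mod N = i" using N by simp
      then have "x = {t (i + N - 1), t (Suc (i + N - 1))}" using e[of "i + N - 1"] i by simp
      then show "x \<in> range (\<lambda>k. {t k, t (Suc k)})" by blast
    qed
  qed
  then show thesis using that N inj by blast
qed

lemma undirected_cycleI:
  fixes t :: "nat \<Rightarrow> 'a"
  assumes N: "3 \<le> N" and inj: "\<And>i j. t i = t j \<longleftrightarrow> i mod N = j mod N"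
    and edge: "\<And>k. {t k, t (Suc k)} \<in> edges G"
  obtains w where "undirected_cycle G w" "edge_of G ` set w \<subseteq> range (\<lambda>k. {t k, t (Suc k)})"
proof -
  have "\<exists>e\<in>arcs G. tail G e = t k \<and> head G e = t (Suc k)" for k
    using edge[of k] unfolding edge_iff ex_arc_iff .
  then obtain e where e: "\<And>k. e k \<in> arcs G" "\<And>k. tail G (e k) = t k" "\<And>k. head G (e k) = t (Suc k)"
    by metis
  define w where "w = map e [0..<N]"
  have "cas (t 0) (map e [0..<m]) (t m)" for m
  proof (induction m)
    case (Suc m)
    then have "awlast (t 0) (map e [0..<m]) = t m" by (rule awlast_if_cas)
    then show ?case using Suc e by (simp add: cas_append_iff)
  qed simp
  then have cas: "cas (t 0) w (t N)" by (simp add: w_def)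
  have tN: "t N = t 0" using inj by simp
  have "awalk (t 0) w (t 0)"
    unfolding awalk_def using cas tN e(1) edge[of 0] verts_eq by (auto simp: w_def edge_iff)
  moreover have "distinct (tl (awalk_verts (t 0) w))"
  proof -
    have ne: "w \<noteq> []" using N by (simp add: w_def)
    have "tl (awalk_verts (t 0) w) = map (head G) w" using awalk_verts_conv'[OF cas] ne by simp
    also have "\<dots> = map (\<lambda>k. t (Suc k)) [0..<N]" by (simp add: w_def e comp_def)
    also have "distinct \<dots>"
      unfolding distinct_map by (auto intro!: inj_onI simp: inj mod_Suc split: if_splits)
    finally show ?thesis .
  qed
  ultimately have "undirected_cycle G w"
    unfolding undirected_cycle_def cycle_def using N by (auto simp: w_def)
  moreover have "edge_of G ` set w \<subseteq> range (\<lambda>k. {t k, t (Suc k)})"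
    by (auto simp: w_def edge_of_def e)
  ultimately show thesis using that by blast
qed

lemma proper_edge_coloringD:
  assumes "proper_edge_coloring G c" "e \<in> edges G" "f \<in> edges G" "e \<noteq> f" "e \<inter> f \<noteq> {}"
  shows "c e \<noteq> c f"
  using assms unfolding proper_edge_coloring_def by blast

lemma proper_edge_coloring_iff:
  "proper_edge_coloring G c \<longleftrightarrow>
    (\<forall>u\<in>U. inj_on (\<lambda>v. c {u, v}) V) \<and> (\<forall>v\<in>V. inj_on (\<lambda>u. c {u, v}) U)"
proof
  assume p: "proper_edge_coloring G c"
  then have p: "e = f" if "e \<in> edges G" "f \<in> edges G" "e \<inter> f \<noteq> {}" "c e = c f" for e f
    using that unfolding proper_edge_coloring_def by blast
  have "{u, v} = {u, v'}" if "u \<in> U" "v \<in> V" "v' \<in> V" "c {u, v} = c {u, v'}" for u v v'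
    using p[of "{u, v}" "{u, v'}"] that by (simp add: edge_iff)
  moreover have "{u, v} = {u', v}" if "v \<in> V" "u \<in> U" "u' \<in> U" "c {u, v} = c {u', v}" for u u' v
    using p[of "{u, v}" "{u', v}"] that by (simp add: edge_iff)
  ultimately show "(\<forall>u\<in>U. inj_on (\<lambda>v. c {u, v}) V) \<and> (\<forall>v\<in>V. inj_on (\<lambda>u. c {u, v}) U)"
    by (fastforce simp: inj_on_def doubleton_eq_iff)
next
  assume i: "(\<forall>u\<in>U. inj_on (\<lambda>v. c {u, v}) V) \<and> (\<forall>v\<in>V. inj_on (\<lambda>u. c {u, v}) U)"
  show "proper_edge_coloring G c"
    unfolding proper_edge_coloring_def
  proof (intro ballI impI)
    fix e f assume ef: "e \<in> edges G" "f \<in> edges G" and ne: "e \<noteq> f \<and> e \<inter> f \<noteq> {}"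
    obtain u v u' v' where uv: "e = {u, v}" "f = {u', v'}" "u \<in> U" "v \<in> V" "u' \<in> U" "v' \<in> V"
      using ef unfolding edges_eq by blast
    have "u = u' \<or> v = v'" using ne uv disj by auto
    then show "c e \<noteq> c f" using i uv ne by (auto dest: inj_onD)
  qed
qed

text \<open>Properness makes the two colors alternate along a bichromatic cycle, so each of its
  vertices has a neighbor of either color on it. Sending the vertices in \<open>U\<close> to these
  neighbors gives two functions onto the same set, the vertices in \<open>V\<close>.\<close>

lemma acyclic_edge_coloring_if_acyclic_array:
  assumes ac: "acyclic_array U V (\<lambda>u v. c {u, v})"
  shows "acyclic_edge_coloring G c"
proof -
  have proper: "proper_edge_coloring G c"
    using ac unfolding proper_edge_coloring_iff acyclic_array_def by blast
  have "\<not> bichromatic G c w" if w: "undirected_cycle G w" for w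
  proof
    assume bi: "bichromatic G c w"
    obtain t :: "nat \<Rightarrow> 'a" and N where N: "3 \<le> N"
      and inj: "\<And>i j. t i = t j \<longleftrightarrow> i mod N = j mod N"
      and E: "edge_of G ` set w = range (\<lambda>k. {t k, t (Suc k)})"
      by (rule undirected_cycleD[OF w]) (rule that; assumption)
    have "set w \<subseteq> arcs G" using w by (auto simp: undirected_cycle_def cycle_def)
    then have "edge_of G ` set w \<subseteq> edges G" unfolding edges_def by (rule image_mono)
    then have edge: "{t k, t (Suc k)} \<in> edges G" for k using E by auto
    obtain a b where cab: "c ` edge_of G ` set w = {a, b}" and ab: "a \<noteq> b"
      using bi unfolding bichromatic_def by (meson card_2_iff)
    have col: "c {t k, t (Suc k)} \<in> {a, b}" for k
      unfolding cab[symmetric] E by simp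
    have next_col: "c {t k, t (Suc k)} \<noteq> c {t (Suc k), t (Suc (Suc k))}" for k
    proof -
      have "t k \<noteq> t (Suc (Suc k))"
        unfolding inj using N by (simp add: mod_Suc)
      then have "{t k, t (Suc k)} \<noteq> {t (Suc k), t (Suc (Suc k))}" by (auto simp: doubleton_eq_iff)
      then show ?thesis by (intro proper_edge_coloringD[OF proper] edge) auto
    qed
    define W where "W = range t"
    have nb: "\<exists>y\<in>W. {x, y} \<in> edges G \<and> c {x, y} = q" if "x \<in> W" "q \<in> {a, b}" for x q
    proof -
      obtain k0 where "x = t k0" using \<open>x \<in> W\<close> by (auto simp: W_def)
      moreover have "t k0 = t (Suc (k0 + N - 1))" using N by (simp add: inj)
      ultimately obtain k where k: "x = t (Suc k)" by blast
      have "c {t k, x} = q \<or> c {x, t (Suc (Suc k))} = q"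
        using col[of k] col[of "Suc k"] next_col[of k] that k by auto
      then show ?thesis using edge[of k] edge[of "Suc k"] k by (metis W_def insert_commute rangeI)
    qed
    define f where "f q x = (SOME y. y \<in> W \<and> {x, y} \<in> edges G \<and> c {x, y} = q)" for q x
    have f: "f q x \<in> W" "{x, f q x} \<in> edges G" "c {x, f q x} = q" if "x \<in> W" "q \<in> {a, b}" for q x
    proof -
      have "\<exists>y. y \<in> W \<and> {x, y} \<in> edges G \<and> c {x, y} = q" using nb[OF that] by blast
      from someI_ex[OF this] show "f q x \<in> W" "{x, f q x} \<in> edges G" "c {x, f q x} = q"
        unfolding f_def by blast+
    qed
    have im: "f q ` (W \<inter> U) = W \<inter> V" if q: "q \<in> {a, b}" for q
    proof
      show "f q ` (W \<inter> U) \<subseteq> W \<inter> V" using f[OF _ q] disj by (auto simp: edge_iff)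
      show "W \<inter> V \<subseteq> f q ` (W \<inter> U)"
      proof
        fix v assume v: "v \<in> W \<inter> V"
        then obtain u where u: "u \<in> W" "{v, u} \<in> edges G" "c {v, u} = q" using nb[of v q] q by blast
        then have uU: "u \<in> U" using v disj by (auto simp: edge_iff)
        have "{u, f q u} = {v, u}"
          using proper_edge_coloringD[OF proper f(2)[OF u(1) q] u(2)] f(3)[OF u(1) q] u(3) by auto
        then have "f q u = v" by (auto simp: doubleton_eq_iff)
        then show "v \<in> f q ` (W \<inter> U)" using u uU by blast
      qed
    qed
    have "t 0 \<in> U \<or> t (Suc 0) \<in> U" using edge[of 0] by (auto simp: edge_iff)
    then have ne: "W \<inter> U \<noteq> {}" by (auto simp: W_def)
    have "a = b"
      by (rule acyclic_arrayD[OF ac _ ne, of "f a" "f b"]) (simp_all add: im f(3))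
    then show False using ab by simp
  qed
  then show ?thesis using proper unfolding acyclic_edge_coloring_def by blast
qed

text \<open>Going along \<open>h\<close> and back along \<open>f\<close> permutes \<open>S\<close>.
  An orbit of length \<open>M\<close>, which closes by finiteness, traces a cycle with
  \<open>2 * M\<close> edges colored \<open>b\<close> and \<open>a\<close> in turn.\<close>

lemma acyclic_array_if_acyclic_edge_coloring:
  assumes fin: "finite U" and ac: "acyclic_edge_coloring G c"
  shows "acyclic_array U V (\<lambda>u v. c {u, v})"
proof -
  have proper: "proper_edge_coloring G c" using ac by (simp add: acyclic_edge_coloring_def)
  have F: False if S: "S \<subseteq> U" "S \<noteq> {}" "f ` S \<subseteq> V" "h ` S = f ` S" and ab: "a \<noteq> b"
    and col: "\<And>x. x \<in> S \<Longrightarrow> c {x, f x} = a" "\<And>x. x \<in> S \<Longrightarrow> c {x, h x} = b" for S f h a b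
  proof -
    have i: "inj_on (\<lambda>u. c {u, v}) U" if "v \<in> V" for v
      using proper that unfolding proper_edge_coloring_iff by blast
    have hV: "h ` S \<subseteq> V" using S by simp
    have injf: "inj_on f S" "inj_on h S"
      using i col S hV by (intro inj_onI; metis image_subset_iff inj_onD subsetD)+
    have finS: "finite S" using S(1) fin by (rule finite_subset)
    define \<tau> where "\<tau> x = inv_into S f (h x)" for x
    have \<tau>: "\<tau> x \<in> S" "f (\<tau> x) = h x" if "x \<in> S" for x
    proof -
      have "h x \<in> f ` S" using that S(4) by blast
      then show "\<tau> x \<in> S" "f (\<tau> x) = h x" unfolding \<tau>_def by (rule inv_into_into, rule f_inv_into_f)
    qed
    have \<tau>inj: "x = y" if "\<tau> x = \<tau> y" "x \<in> S" "y \<in> S" for x y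
      using that \<tau> injf(2) by (metis inj_onD)
    obtain x0 where x0: "x0 \<in> S" using S by blast
    define s where "s k = (\<tau> ^^ k) x0" for k
    have sS: "s k \<in> S" for k by (induction k) (auto simp: s_def x0 \<tau>)
    have s_add: "s (k + i) = s (k + j) \<Longrightarrow> s i = s j" for i j k
    proof (induction k)
      case (Suc k)
      have "\<tau> (s (k + i)) = \<tau> (s (k + j))" using Suc.prems by (simp add: s_def)
      then show ?case using Suc.IH \<tau>inj sS by blast
    qed simp
    have "\<not> inj s" using finS sS by (metis finite_subset image_subsetI infinite_UNIV_nat finite_imageD)
    then obtain i j where "s i = s j" "i < j" unfolding inj_on_def by (metis nat_neq_iff)
    then have "\<exists>M>0. s M = s 0" using s_add[of i "j - i" 0] by (intro exI[of _ "j - i"]) simp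
    define M where "M = (LEAST M. 0 < M \<and> s M = s 0)"
    have M: "0 < M" "s M = s 0" and least: "\<And>k. 0 < k \<Longrightarrow> s k = s 0 \<Longrightarrow> M \<le> k"
      using LeastI_ex[OF \<open>\<exists>M>0. s M = s 0\<close>] unfolding M_def by (simp_all add: Least_le)
    have per: "s (k + M) = s k" for k
      using M(2) unfolding s_def funpow_add comp_def by simp
    have s_mod: "s (k mod M) = s k" for k
    proof -
      have "s (r + q * M) = s r" for r q
        by (induction q) (simp, metis add.assoc add.commute mult_Suc per)
      from this[of "k mod M" "k div M"] show ?thesis by simp
    qed
    have s_lt: "i = j" if "s i = s j" "i < M" "j < M" for i j
      using that
    proof (induction i j rule: linorder_wlog)
      case (le i j)
      then have "s (j - i) = s 0" using s_add[of i "j - i" 0] by simp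
      then show ?case using least[of "j - i"] le by (cases "i = j") auto
    qed simp
    have s_eq: "s i = s j \<longleftrightarrow> i mod M = j mod M" for i j
      using s_lt[of "i mod M" "j mod M"] s_mod M(1) by (metis mod_less_divisor)
    have fh: "f x \<noteq> h x" if "x \<in> S" for x using col[OF that] ab by auto
    \<comment> \<open>An orbit of length one would be a single edge carrying both colors.\<close>
    have "M \<noteq> 1"
    proof
      assume "M = 1"
      then have "\<tau> x0 = x0" using M(2) by (simp add: s_def)
      then show False using \<tau>[OF x0] fh[OF x0] by simp
    qed
    then have M2: "2 \<le> M" using M(1) by simp
    define t where "t k = (if even k then s (k div 2) else h (s (k div 2)))" for k
    have tU: "t k \<in> U" if "even k" for k using that sS S(1) by (auto simp: t_def)
    have tV: "t k \<in> V" if "odd k" for k using that sS hV by (auto simp: t_def)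
    have modM: "i mod (2 * M) = j mod (2 * M) \<longleftrightarrow> (even i = even j) \<and> (i div 2) mod M = (j div 2) mod M" for i j
    proof -
      have "2 * x + i mod 2 = 2 * y + j mod 2 \<longleftrightarrow> even i = even j \<and> x = y" for x y
        unfolding mod_2_eq_odd by (auto simp: of_bool_def split: if_splits; arith)
      then show ?thesis unfolding mod_mult2_eq .
    qed
    have t_inj: "t i = t j \<longleftrightarrow> i mod (2 * M) = j mod (2 * M)" for i j
    proof (cases "even i = even j")
      case True
      then have "t i = t j \<longleftrightarrow> s (i div 2) = s (j div 2)"
        using injf(2) sS by (auto simp: t_def inj_on_eq_iff)
      then show ?thesis using True by (simp add: s_eq modM)
    next
      case False
      then have "t i \<noteq> t j" using tU tV disj by (metis disjoint_iff)
      then show ?thesis using False by (simp add: modM)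
    qed
    have edge: "{t k, t (Suc k)} \<in> edges G" for k
      unfolding edge_iff using tU[of k] tV[of k] tU[of "Suc k"] tV[of "Suc k"] by (cases "even k") auto
    have N3: "3 \<le> 2 * M" using M2 by simp
    obtain w where w: "undirected_cycle G w" and E: "edge_of G ` set w \<subseteq> range (\<lambda>k. {t k, t (Suc k)})"
      by (rule undirected_cycleI[OF N3 t_inj edge]) (rule that; assumption)
    have tcol: "c {t k, t (Suc k)} \<in> {a, b}" for k
    proof (cases "even k")
      case True
      then show ?thesis using col(2) sS by (auto simp: t_def)
    next
      case False
      then have "t (Suc k) = \<tau> (s (k div 2))" by (simp add: t_def s_def)
      moreover have "t k = f (\<tau> (s (k div 2)))" using False \<tau> sS by (simp add: t_def)
      ultimately show ?thesis using col(1)[of "\<tau> (s (k div 2))"] \<tau> sS by (simp add: insert_commute)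
    qed
    have "c ` edge_of G ` set w \<subseteq> c ` range (\<lambda>k. {t k, t (Suc k)})"
      using E by (rule image_mono)
    also have "\<dots> \<subseteq> {a, b}" using tcol by auto
    finally have sub: "c ` edge_of G ` set w \<subseteq> {a, b}" .
    have wA: "set w \<subseteq> arcs G" "w \<noteq> []" using w by (auto simp: undirected_cycle_def cycle_def)
    \<comment> \<open>\<open>bichromatic\<close> asks for exactly two colors; that only one occurs
      is refuted by two consecutive edges of the cycle.\<close>
    have "card (c ` edge_of G ` set w) \<noteq> 2"
      using ac w unfolding acyclic_edge_coloring_def bichromatic_def by blast
    moreover have "card (c ` edge_of G ` set w) \<le> 2"
      using card_mono[OF _ sub] ab by simp
    ultimately have "card (c ` edge_of G ` set w) \<le> 1" by simp
    then have mono: "c e = c e'" if "e \<in> edge_of G ` set w" "e' \<in> edge_of G ` set w" for e e'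
    proof -
      have "c e \<in> c ` edge_of G ` set w" "c e' \<in> c ` edge_of G ` set w" using that by (auto intro: imageI)
      then show ?thesis
        using \<open>card (c ` edge_of G ` set w) \<le> 1\<close> by (metis One_nat_def card_le_Suc0_iff_eq finite_imageI finite_set)
    qed
    obtain t' :: "nat \<Rightarrow> 'a" and N where N: "3 \<le> N" and inj: "\<And>i j. t' i = t' j \<longleftrightarrow> i mod N = j mod N"
      and E': "edge_of G ` set w = range (\<lambda>k. {t' k, t' (Suc k)})"
      by (rule undirected_cycleD[OF w]) (rule that; assumption)
    have "t' 0 \<noteq> t' 2" "t' 0 \<noteq> t' 1" using N by (simp_all add: inj)
    then have "{t' 0, t' 1} \<noteq> {t' 1, t' 2}" by (auto simp: doubleton_eq_iff)
    moreover have "{t' 0, t' 1} \<in> edge_of G ` set w" "{t' 1, t' 2} \<in> edge_of G ` set w"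
      using rangeI[of "\<lambda>k. {t' k, t' (Suc k)}" 0] rangeI[of "\<lambda>k. {t' k, t' (Suc k)}" 1]
      unfolding E' by (simp_all add: numeral_2_eq_2)
    moreover have "edge_of G ` set w \<subseteq> edges G" using wA by (auto simp: edges_def)
    ultimately show False
      using proper_edge_coloringD[OF proper, of "{t' 0, t' 1}" "{t' 1, t' 2}"]
        mono[of "{t' 0, t' 1}" "{t' 1, t' 2}"] by auto
  qed
  then show ?thesis
    using proper unfolding proper_edge_coloring_iff by (intro acyclic_arrayI) blast+
qed

end

subsection \<open>A perfect 1-factorization\<close>

text \<open>By Fermat's theorem the order of a square divides \<open>(p - 1) div 2\<close>, so a
  primitive root is not a square. One \<open>g\<close> has to serve both purposes: as a nonsquare it
  makes pairs of factors Hamiltonian, as a generator it drives the orbits of \<open>alpha\<close>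
  onto the uncovered lines.\<close>

lemma ex_primitive_root_nonsquare:
  fixes p :: nat
  assumes p: "prime p" "2 < p"
  obtains g :: int where "\<And>a. \<not> int p dvd a \<Longrightarrow> \<exists>k. int p dvd g ^ k - a"
    and "\<And>r. \<not> int p dvd r\<^sup>2 - g"
proof -
  have p1: "1 < p" using p by simp
  obtain h where h: "residue_primroot p h" using prime_primitive_root_exists[OF p1 p(1)] by blast
  define g where "g = int h"
  have gen: "\<exists>k. int p dvd g ^ k - a" if a: "\<not> int p dvd a" for a
  proof -
    define b where "b = nat (a mod int p)"
    have b: "int b = a mod int p" using p by (simp add: b_def)
    then have "\<not> p dvd b" using a by (metis dvd_mod_iff dvd_refl int_dvd_int_iff)
    then have "coprime p b" using p by (simp add: prime_imp_coprime)
    moreover have "int b < int p" unfolding b using p by simp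
    moreover have "0 < b" using \<open>\<not> p dvd b\<close> by (cases b) auto
    ultimately have "b \<in> totatives p" by (simp add: totatives_def coprime_commute)
    then have "b \<in> (\<lambda>i. h ^ i mod p) ` {..<totient p}"
      using bij_betw_imp_surj_on[OF residue_primroot_is_generator[OF p1 h]] by simp
    then obtain k where "b = h ^ k mod p" by blast
    then have "g ^ k mod int p = a mod int p"
      unfolding b[symmetric] g_def by (simp add: of_nat_mod)
    then show ?thesis by (auto simp: mod_eq_dvd_iff)
  qed
  have "\<not> int p dvd r\<^sup>2 - g" for r
  proof
    assume r: "int p dvd r\<^sup>2 - g"
    define s where "s = nat (r mod int p)"
    have s: "int s = r mod int p" using p by (simp add: s_def)
    have "(int s)\<^sup>2 mod int p = g mod int p"
      using r unfolding s by (simp add: power_mod mod_eq_dvd_iff)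
    then have sh: "[s\<^sup>2 = h] (mod p)"
      unfolding g_def cong_def by (metis of_nat_eq_iff of_nat_mod of_nat_power)
    have cop: "coprime p h" and ord: "ord p h = p - 1"
      using h p by (auto simp: residue_primroot_def totient_prime)
    have "\<not> p dvd s"
    proof
      assume "p dvd s"
      then have "p dvd h" using sh by (metis cong_dvd_iff dvd_power zero_less_numeral dvd_trans)
      then show False using cop p by (metis coprime_absorb_left not_prime_unit)
    qed
    then have fermat: "[s ^ (p - 1) = 1] (mod p)" by (rule fermat_theorem[OF p(1)])
    have "odd p" using p prime_odd_nat by auto
    then have half: "2 * ((p - 1) div 2) = p - 1" by simp
    have "[h ^ ((p - 1) div 2) = (s\<^sup>2) ^ ((p - 1) div 2)] (mod p)"
      using sh by (intro cong_pow) (rule cong_sym)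
    also have "(s\<^sup>2) ^ ((p - 1) div 2) = s ^ (p - 1)" by (simp only: power_mult[symmetric] half)
    finally have "[h ^ ((p - 1) div 2) = 1] (mod p)" using fermat by (rule cong_trans)
    then have "p - 1 dvd (p - 1) div 2" using ord ord_divides by metis
    moreover have "0 < (p - 1) div 2" "(p - 1) div 2 < p - 1" using p by auto
    ultimately show False by (meson dvd_imp_le leD)
  qed
  then show thesis using that gen by blast
qed

text \<open>Congruences are derived from others by naming the cofactors; what remains is a ring
  identity for the simplifier.\<close>

lemma dvd_lin1: "(p::int) dvd a \<Longrightarrow> t = a * c \<Longrightarrow> p dvd t"
  by simp

lemma dvd_lin2: "(p::int) dvd a \<Longrightarrow> p dvd b \<Longrightarrow> t = a * c + b * d \<Longrightarrow> p dvd t"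
  by simp

lemma dvd_lin3: "(p::int) dvd a \<Longrightarrow> p dvd b \<Longrightarrow> p dvd e \<Longrightarrow> t = a * c + b * d + e * f \<Longrightarrow> p dvd t"
  by simp

section \<open>Residues modulo a prime and the odometer on two coordinates\<close>

locale primitive_root =
  fixes p g :: int
  assumes prime: "prime p" and p_ge: "5 \<le> p"
    and gen: "\<And>a. \<not> p dvd a \<Longrightarrow> \<exists>k. p dvd g ^ k - a"
    and nonsquare: "\<And>r. \<not> p dvd r\<^sup>2 - g"
begin

lemma dvd_mult_iff: "p dvd a * b \<longleftrightarrow> p dvd a \<or> p dvd b"
  using prime by (simp add: prime_dvd_mult_iff)

lemma g_facts: "\<not> p dvd g" "\<not> p dvd g - 1"
  using nonsquare[of 0] nonsquare[of 1] dvd_diff_commute[of p 1 g] by auto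

lemma small_dvd: "p dvd a \<Longrightarrow> \<bar>a\<bar> < p \<Longrightarrow> a = 0"
  using zdvd_not_zless[of "\<bar>a\<bar>" p] by fastforce

lemma inverse_mod:
  assumes "\<not> p dvd a"
  obtains b where "p dvd a * b - 1"
proof -
  have "coprime a p" using prime_imp_coprime[OF prime assms] by (simp add: coprime_commute)
  then show thesis using cong_solve_coprime_int that by (metis cong_iff_dvd_diff)
qed

lemma solve_mod:
  assumes "\<not> p dvd a"
  obtains k :: nat where "int k < p" "p dvd x + int k * a"
proof -
  obtain b where b: "p dvd a * b - 1" using inverse_mod[OF assms] .
  define k where "k = nat ((- x * b) mod p)"
  have k: "int k = (- x * b) mod p" "int k < p" using p_ge by (simp_all add: k_def)
  then have "p dvd int k - (- x * b)" by (metis dvd_diff_commute dvd_minus_mod)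
  then have "p dvd x + int k * a"
    by (rule dvd_lin2[OF b, where c = "- x" and d = a]) (simp add: algebra_simps)
  with k show thesis using that by blast
qed

text \<open>Hitting times counted from 1 belong to a coordinate that is tested only after a move; a
  start on the line itself is hit again at \<open>k = p\<close>.\<close>

lemma solve_mod_pos:
  assumes "\<not> p dvd a"
  obtains k :: nat where "0 < k" "int k \<le> p" "p dvd x + int k * a"
proof -
  obtain k :: nat where "int k < p" "p dvd (x + a) + int k * a" using solve_mod[OF assms] .
  then show thesis using that[of "Suc k"] by (simp add: algebra_simps)
qed

lemma solve_mod_unique:
  fixes k m :: nat
  assumes "\<not> p dvd a" "p dvd x + int k * a" "p dvd x + int m * a" "\<bar>int k - int m\<bar> < p"
  shows "k = m"
proof -
  have "p dvd (int k - int m) * a"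
    by (rule dvd_lin2[OF assms(2,3), where c = 1 and d = "- 1"]) (simp add: algebra_simps)
  then have "p dvd int k - int m" using assms(1) dvd_mult_iff by blast
  then show ?thesis using small_dvd[OF _ assms(4)] by simp
qed

definition iz :: "int \<Rightarrow> int" where
  "iz x = (if p dvd x then 1 else 0)"

lemma iz_simps [simp]: "p dvd x \<Longrightarrow> iz x = 1" "\<not> p dvd x \<Longrightarrow> iz x = 0"
  by (simp_all add: iz_def)

text \<open>
  If \<open>A\<close> and \<open>B\<close> are nonzero, the first return to the line \<open>v = 0\<close> translates it by
  \<open>(B\<^sup>2 * g - A\<^sup>2) / B\<close>, which is nonzero because \<open>g\<close> is not a square.
\<close>

lemma two_coordinate_odometer:
  fixes P :: "int \<Rightarrow> int \<Rightarrow> bool"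
  assumes per: "\<And>x v x' v'. P x v \<Longrightarrow> p dvd x - x' \<Longrightarrow> p dvd v - v' \<Longrightarrow> P x' v'"
    and step: "\<And>x v. P x v \<Longrightarrow> P (x + A + B * g * iz v) (v + B + A * iz (x + A + B * g * iz v))"
    and P0: "P x0 v0" and AB: "\<not> (p dvd A \<and> p dvd B)"
  shows "P 0 0"
proof -
  \<comment> \<open>Off both lines the step is a translation. It tests \<open>v\<close> before the
    move and \<open>x\<close> after it, hence the two ranges of \<open>m\<close>.\<close>
  have drift: "P (x + int k * A) (v + int k * B)"
    if "P x v" "\<And>m. m < k \<Longrightarrow> \<not> p dvd v + int m * B"
      "\<And>m. 0 < m \<Longrightarrow> m \<le> k \<Longrightarrow> \<not> p dvd x + int m * A" for x v k
    using that
  proof (induction k)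
    case (Suc k)
    have "P (x + int k * A) (v + int k * B)" by (rule Suc.IH) (use Suc.prems in auto)
    from step[OF this] show ?case
      using Suc.prems(2)[of k] Suc.prems(3)[of "Suc k"] by (simp add: algebra_simps)
  qed simp
  have reach: "\<exists>v'. P 0 v'" if Pxv: "P x v" and l: "0 < l" "p dvd x + int l * A"
    "\<And>m. 0 < m \<Longrightarrow> m < l \<Longrightarrow> \<not> p dvd x + int m * A"
    "\<And>m. m < l \<Longrightarrow> \<not> p dvd v + int m * B" for x v l
  proof -
    obtain k where k: "l = Suc k" using l(1) by (cases l) auto
    have "P (x + int k * A) (v + int k * B)" by (rule drift[OF Pxv]) (use l k in auto)
    from per[OF step[OF this], of 0 "v + int l * B + A"] have "P 0 (v + int l * B + A)"
      using l(2) l(4)[of k] k by (simp add: algebra_simps)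
    then show ?thesis ..
  qed
  consider "p dvd B" "\<not> p dvd A" | "p dvd A" "\<not> p dvd B" | "\<not> p dvd A" "\<not> p dvd B"
    using AB by blast
  then show ?thesis
  proof cases
    case 1
    \<comment> \<open>For \<open>B = 0\<close> the coordinate \<open>x\<close> runs through all
      residues, and each passage through 0 moves \<open>v\<close> by \<open>A\<close>. The next case
      is the mirror image, with jumps of \<open>x\<close> by \<open>B * g\<close>.\<close>
    have step1: "P (x + A) (v + A * iz (x + A))" if "P x v" for x v
    proof -
      have dBg: "p dvd B * g * iz v" using 1 by simp
      have "p dvd (x + A + B * g * iz v) \<longleftrightarrow> p dvd x + A"
        using dvd_add_left_iff[OF dBg] by simp
      then have "iz (x + A + B * g * iz v) = iz (x + A)" by (simp add: iz_def)
      with step[OF that] have "P (x + A + B * g * iz v) (v + B + A * iz (x + A))" by simp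
      then show ?thesis by (rule per) (use dBg 1 in simp_all)
    qed
    have walk: "P (x + int k * A) v"
      if "P x v" "\<And>m. 0 < m \<Longrightarrow> m \<le> k \<Longrightarrow> \<not> p dvd x + int m * A" for x v k
      using that
    proof (induction k)
      case (Suc k)
      have "P (x + int k * A) v" by (rule Suc.IH) (use Suc.prems in auto)
      from step1[OF this] show ?case
        using Suc.prems(2)[of "Suc k"] by (simp add: algebra_simps)
    qed simp
    have hit: "P 0 (v + A)" if "P x v" for x v
    proof -
      obtain l :: nat where l: "0 < l" "int l \<le> p" "p dvd x + int l * A"
        using solve_mod_pos[OF 1(2)] .
      then obtain k where k: "l = Suc k" by (cases l) auto
      have "\<not> p dvd x + int m * A" if m: "0 < m" "m \<le> k" for m
        using solve_mod_unique[OF 1(2) _ l(3), of m] m l k by auto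
      then have "P (x + int k * A) v" by (intro walk[OF that])
      from per[OF step1[OF this], of 0 "v + A"] show ?thesis
        using l(3) k by (simp add: algebra_simps)
    qed
    have hits: "P 0 (v0 + int (Suc n) * A)" for n
    proof (induction n)
      case 0
      then show ?case using hit[OF P0] by simp
    next
      case (Suc n)
      from hit[OF this] show ?case by (simp add: algebra_simps)
    qed
    obtain n :: nat where n: "0 < n" "p dvd v0 + int n * A" using solve_mod_pos[OF 1(2)] by metis
    then show ?thesis using per[OF hits[of "n - 1"], of 0 0] by simp
  next
    case 2
    have step2: "P (x + B * g * iz v) (v + B)" if "P x v" for x v
    proof -
      have d: "p dvd A * y" for y using 2 by simp
      show ?thesis by (rule per[OF step[OF that]]) (use d 2 in simp_all)
    qed
    have walk: "P x (v + int k * B)"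
      if "P x v" "\<And>m. m < k \<Longrightarrow> \<not> p dvd v + int m * B" for x v k
      using that
    proof (induction k)
      case (Suc k)
      have "P x (v + int k * B)" by (rule Suc.IH) (use Suc.prems in auto)
      from step2[OF this] show ?case
        using Suc.prems(2)[of k] by (simp add: algebra_simps)
    qed simp
    have to0: "P x 0" if "P x v" for x v
    proof -
      obtain l :: nat where l: "int l < p" "p dvd v + int l * B" using solve_mod[OF 2(2)] .
      have "\<not> p dvd v + int m * B" if "m < l" for m
        using solve_mod_unique[OF 2(2) _ l(2), of m] that l by auto
      then have "P x (v + int l * B)" by (intro walk[OF that])
      from per[OF this, of x 0] show ?thesis using l by simp
    qed
    have hits: "P (x0 + int n * (B * g)) 0" for n
    proof (induction n)
      case 0
      then show ?case using to0[OF P0] by simp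
    next
      case (Suc n)
      from to0[OF step2[OF this]] show ?case by (simp add: algebra_simps)
    qed
    have "\<not> p dvd B * g" using 2 g_facts dvd_mult_iff by blast
    then obtain n :: nat where "p dvd x0 + int n * (B * g)" using solve_mod by metis
    then show ?thesis using per[OF hits[of n], of 0 0] by simp
  next
    case 3
    have from_axis: "\<exists>e. P e 0 \<and> p dvd e * B + v * A" if "P 0 v" for v
    proof -
      obtain r :: nat where r: "int r < p" "p dvd v + int r * B" using solve_mod[OF 3(2)] .
      have "P (0 + int r * A) (v + int r * B)"
      proof (rule drift[OF that])
        fix m assume "m < r"
        then show "\<not> p dvd v + int m * B"
          using solve_mod_unique[OF 3(2) _ r(2), of m] r by auto
      next
        fix m assume "0 < m" "m \<le> r"
        then show "\<not> p dvd 0 + int m * A"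
          using solve_mod_unique[OF 3(1), of 0 m 0] r by auto
      qed
      from per[OF this, of "int r * A" 0] have "P (int r * A) 0" using r by simp
      moreover have "p dvd int r * A * B + v * A"
        by (rule dvd_lin1[OF r(2), where c = A]) (simp add: algebra_simps)
      ultimately show ?thesis by blast
    qed
    \<comment> \<open>The correction at the start is absorbed into \<open>d'\<close>. After
      \<open>l\<close> moves the point is \<open>(0, l * B + A)\<close>, from where v = 0 is reached
      at \<open>- (l * B + A) * A / B\<close>. Eliminating \<open>l\<close> by means of
      \<open>d' + l * A = 0\<close> gives the shift.\<close>
    have return: "\<exists>e. P e 0 \<and> p dvd e * B - (d * B + (B\<^sup>2 * g - A\<^sup>2))" if Pd: "P d 0" for d
    proof -
      define d' where "d' = d + B * g"
      obtain l :: nat where l: "0 < l" "int l \<le> p" "p dvd d' + int l * A"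
        using solve_mod_pos[OF 3(1)] .
      have nx: "\<not> p dvd d' + int m * A" if "0 < m" "m < l" for m
        using solve_mod_unique[OF 3(1) _ l(3), of m] that l by auto
      have nv: "\<not> p dvd int m * B" if "0 < m" "m < l" for m
        using solve_mod_unique[OF 3(2), of 0 m 0] that l by auto
      have run: "P (d' + int (Suc m) * A) (int (Suc m) * B + A * iz (d' + int (Suc m) * A))" if "Suc m \<le> l" for m
        using that
      proof (induction m)
        case 0
        from step[OF Pd] show ?case by (simp add: d'_def algebra_simps)
      next
        case (Suc m)
        then have "P (d' + int (Suc m) * A) (int (Suc m) * B)" using nx[of "Suc m"] by simp
        from step[OF this] show ?case using nv[of "Suc m"] Suc.prems by (simp add: algebra_simps)
      qed
      have "P 0 (int l * B + A)"
        using per[OF run[of "l - 1"], of 0] l by simp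
      then obtain e where e: "P e 0" "p dvd e * B + (int l * B + A) * A" using from_axis by blast
      have "p dvd e * B - (d * B + (B\<^sup>2 * g - A\<^sup>2))"
        by (rule dvd_lin2[OF e(2) l(3), where c = 1 and d = "- B"])
          (simp add: d'_def algebra_simps power2_eq_square)
      then show ?thesis using e by blast
    qed
    \<comment> \<open>Otherwise \<open>A / B\<close> would be a square root of
      \<open>g\<close>.\<close>
    have K: "\<not> p dvd B\<^sup>2 * g - A\<^sup>2"
    proof
      assume K: "p dvd B\<^sup>2 * g - A\<^sup>2"
      obtain b where b: "p dvd B * b - 1" using inverse_mod[OF 3(2)] .
      have "p dvd (A * b)\<^sup>2 - g"
        by (rule dvd_lin2[OF K b, where c = "- b\<^sup>2" and d = "g * (B * b + 1)"])
          (simp add: algebra_simps power2_eq_square)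
      then show False using nonsquare by blast
    qed
    have "\<exists>d. P d 0"
    proof -
      obtain k :: nat where k: "int k < p" "p dvd v0 + int k * B" using solve_mod[OF 3(2)] .
      obtain l :: nat where l: "0 < l" "int l \<le> p" "p dvd x0 + int l * A"
        using solve_mod_pos[OF 3(1)] .
      have nx: "\<not> p dvd x0 + int m * A" if "0 < m" "m < l" for m
        using solve_mod_unique[OF 3(1) _ l(3), of m] that l by auto
      have nv: "\<not> p dvd v0 + int m * B" if "m < k" for m
        using solve_mod_unique[OF 3(2) _ k(2), of m] that k by auto
      show ?thesis
      proof (cases "k < l")
        case True
        then have "P (x0 + int k * A) (v0 + int k * B)" using nx nv by (intro drift[OF P0]) auto
        from per[OF this, of "x0 + int k * A" 0] show ?thesis using k by auto
      next
        case False
        then have "\<exists>v. P 0 v" using l nx nv by (intro reach[OF P0]) auto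
        then show ?thesis using from_axis by blast
      qed
    qed
    then obtain d where d: "P d 0" by blast
    have iter: "\<exists>e. P e 0 \<and> p dvd e * B - (d * B + int n * (B\<^sup>2 * g - A\<^sup>2))" for n
    proof (induction n)
      case 0
      then show ?case using d by (intro exI[of _ d]) simp
    next
      case (Suc n)
      then obtain e where e: "P e 0" "p dvd e * B - (d * B + int n * (B\<^sup>2 * g - A\<^sup>2))" by blast
      obtain f where f: "P f 0" "p dvd f * B - (e * B + (B\<^sup>2 * g - A\<^sup>2))" using return[OF e(1)] by blast
      have "p dvd f * B - (d * B + int (Suc n) * (B\<^sup>2 * g - A\<^sup>2))"
        by (rule dvd_lin2[OF e(2) f(2), where c = 1 and d = 1]) (simp add: algebra_simps)
      then show ?case using f by blast
    qed
    \<comment> \<open>As the shift is nonzero, some number of returns carries \<open>d\<close> to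
      0.\<close>
    obtain n :: nat where n: "p dvd d * B + int n * (B\<^sup>2 * g - A\<^sup>2)" using solve_mod[OF K] by metis
    obtain e where e: "P e 0" "p dvd e * B - (d * B + int n * (B\<^sup>2 * g - A\<^sup>2))" using iter by blast
    have "p dvd e * B" by (rule dvd_lin2[OF n e(2), where c = 1 and d = 1]) simp
    then have "p dvd e" using 3(2) dvd_mult_iff by blast
    then show ?thesis using per[OF e(1), of 0 0] by simp
  qed
qed

end

section \<open>Factors of the complete bipartite graph on two copies of the plane modulo
  \<open>p\<close>\<close>

context primitive_root
begin

lemma p_pos: "0 < p" using p_ge by simp

lemma small_not_dvd: "a \<noteq> 0 \<Longrightarrow> \<bar>a\<bar> < p \<Longrightarrow> \<not> p dvd a"
  using small_dvd by blast

lemma iz_cong: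
  assumes "p dvd x - y"
  shows "iz x = iz y"
proof -
  have "p dvd x \<longleftrightarrow> p dvd y" using dvd_add_right_iff[OF assms, of y] by simp
  then show ?thesis by (simp add: iz_def)
qed

text \<open>The same set serves as both vertex classes and as the set of original colors.\<close>

definition grid :: "(int \<times> int) set" where
  "grid = {0..<p} \<times> {0..<p}"

lemma grid_iff: "z \<in> grid \<longleftrightarrow> 0 \<le> fst z \<and> fst z < p \<and> 0 \<le> snd z \<and> snd z < p"
  by (cases z) (auto simp: grid_def)

lemma finite_grid: "finite grid"
  by (simp add: grid_def)

lemma grid_eqI:
  assumes "z \<in> grid" "z' \<in> grid" "p dvd fst z - fst z'" "p dvd snd z - snd z'"
  shows "z = z'"
  using small_dvd[OF assms(3)] small_dvd[OF assms(4)] assms(1,2)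
  by (cases z; cases z') (auto simp: grid_iff)

lemma mod_grid: "(x mod p, y mod p) \<in> grid"
  using p_pos by (simp add: grid_iff)

lemma mod_pair_eq_iff: "(x mod p, y mod p) = (x' mod p, y' mod p) \<longleftrightarrow> p dvd x - x' \<and> p dvd y - y'"
  by (simp add: mod_eq_dvd_iff)

text \<open>
  The factors form a perfect 1-factorization. In the coordinates \<open>(x, v)\<close>, where \<open>v\<close> is the second
  coordinate of the image, passing from factor \<open>a\<close> to factor \<open>b\<close> is a step of the odometer above
  with \<open>(A, B) = a - b\<close>.
\<close>

definition factor :: "int \<times> int \<Rightarrow> int \<times> int \<Rightarrow> int \<times> int" where
  "factor a z = (let v = snd z + snd a + iz (fst z) * fst a
    in ((fst z + fst a + g * iz v * snd a) mod p, v mod p))"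

lemma factor_eq_iff:
  "factor a z = (u mod p, v mod p) \<longleftrightarrow>
    p dvd fst z + fst a + g * iz v * snd a - u \<and> p dvd snd z + snd a + iz (fst z) * fst a - v"
  unfolding factor_def Let_def mod_pair_eq_iff
  using iz_cong[of "snd z + snd a + iz (fst z) * fst a" v]
  by (cases "p dvd snd z + snd a + iz (fst z) * fst a - v") simp_all

lemma factor_in_grid: "factor a z \<in> grid"
  by (simp add: factor_def Let_def mod_grid)

lemma dest_factor:
  obtains u v where "factor a z = (u mod p, v mod p)"
    "p dvd fst z + fst a + g * iz v * snd a - u" "p dvd snd z + snd a + iz (fst z) * fst a - v"
proof -
  obtain u v where "factor a z = (u mod p, v mod p)" unfolding factor_def Let_def by blast
  then show thesis using that factor_eq_iff by blast
qed

lemma bij_factor: "bij_betw (factor a) grid grid"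
proof -
  have inj: "inj_on (factor a) grid"
  proof (rule inj_onI)
    fix z z' assume z: "z \<in> grid" "z' \<in> grid" "factor a z = factor a z'"
    obtain u v where uv: "factor a z = (u mod p, v mod p)"
      "p dvd fst z + fst a + g * iz v * snd a - u" "p dvd snd z + snd a + iz (fst z) * fst a - v"
      by (rule dest_factor)
    have uv': "p dvd fst z' + fst a + g * iz v * snd a - u" "p dvd snd z' + snd a + iz (fst z') * fst a - v"
      using uv(1) z(3) factor_eq_iff by metis+
    have x: "p dvd fst z - fst z'"
      by (rule dvd_lin2[OF uv(2) uv'(1), where c = 1 and d = "- 1"]) simp
    then have "iz (fst z) = iz (fst z')" by (rule iz_cong)
    then have "p dvd snd z - snd z'"
      by (intro dvd_lin2[OF uv(3) uv'(2), where c = 1 and d = "- 1"]) simp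
    then show "z = z'" using grid_eqI z x by blast
  qed
  have "factor a ` grid = grid"
    by (rule endo_inj_surj[OF finite_grid _ inj]) (use factor_in_grid in blast)
  with inj show ?thesis by (simp add: bij_betw_def)
qed

text \<open>The difference of two colors with the same image solves a linear system of determinant
  \<open>1 - g * iz v * iz (fst z)\<close>. This is 1 or \<open>1 - g\<close>, and \<open>g\<close>
  is not 1 because 1 is a square.\<close>

lemma bij_factor_color:
  assumes "z \<in> grid"
  shows "bij_betw (\<lambda>a. factor a z) grid grid"
proof -
  have inj: "inj_on (\<lambda>a. factor a z) grid"
  proof (rule inj_onI)
    fix a b assume ab: "a \<in> grid" "b \<in> grid" "factor a z = factor b z"
    obtain u v where uv: "factor a z = (u mod p, v mod p)"
      "p dvd fst z + fst a + g * iz v * snd a - u" "p dvd snd z + snd a + iz (fst z) * fst a - v"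
      by (rule dest_factor)
    have uv': "p dvd fst z + fst b + g * iz v * snd b - u" "p dvd snd z + snd b + iz (fst z) * fst b - v"
      using uv(1) ab(3) factor_eq_iff by metis+
    define i j where "i = fst a - fst b" and "j = snd a - snd b"
    have 1: "p dvd i + g * iz v * j"
      by (rule dvd_lin2[OF uv(2) uv'(1), where c = 1 and d = "- 1"]) (simp add: i_def j_def algebra_simps)
    have 2: "p dvd j + iz (fst z) * i"
      by (rule dvd_lin2[OF uv(3) uv'(2), where c = 1 and d = "- 1"]) (simp add: i_def j_def algebra_simps)
    have "p dvd i * (1 - g * iz v * iz (fst z))"
      by (rule dvd_lin2[OF 1 2, where c = 1 and d = "- g * iz v"]) (simp add: algebra_simps)
    moreover have "\<not> p dvd 1 - g * iz v * iz (fst z)"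
      using g_facts(2) dvd_diff_commute[of p 1 g] small_not_dvd[of 1] p_ge by (auto simp: iz_def)
    ultimately have "p dvd i" using dvd_mult_iff by blast
    then have "p dvd j" by (rule dvd_lin2[OF _ 2, where c = "- iz (fst z)" and d = 1]) simp
    then show "a = b" using \<open>p dvd i\<close> ab grid_eqI by (simp add: i_def j_def)
  qed
  have "(\<lambda>a. factor a z) ` grid = grid"
    by (rule endo_inj_surj[OF finite_grid _ inj]) (use factor_in_grid in blast)
  with inj show ?thesis by (simp add: bij_betw_def)
qed

text \<open>The odometer reaches x = v = 0. The vertex lying there depends on \<open>a\<close>
  alone, so all closed sets share it.\<close>

lemma factor_pair_base_point:
  assumes ab: "a \<in> grid" "b \<in> grid" "a \<noteq> b" and S: "S \<subseteq> grid" "S \<noteq> {}"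
    and eq: "factor a ` S = factor b ` S"
  shows "(0, (- fst a - snd a) mod p) \<in> S"
proof -
  define A B where "A = fst a - fst b" and "B = snd a - snd b"
  define P where "P x v \<longleftrightarrow> (\<exists>z\<in>S. p dvd fst z - x \<and> p dvd snd z + snd a + iz (fst z) * fst a - v)" for x v
  obtain z0 where "z0 \<in> S" using S by blast
  then have P0: "P (fst z0) (snd z0 + snd a + iz (fst z0) * fst a)" unfolding P_def by force
  have "P 0 0"
  proof (rule two_coordinate_odometer[where P = P and A = A and B = B, OF _ _ P0])
    show "P x' v'" if "P x v" "p dvd x - x'" "p dvd v - v'" for x v x' v'
    proof -
      obtain z where z: "z \<in> S" "p dvd fst z - x" "p dvd snd z + snd a + iz (fst z) * fst a - v"
        using \<open>P x v\<close> unfolding P_def by blast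
      have "p dvd fst z - x'" by (rule dvd_lin2[OF z(2) that(2), where c = 1 and d = 1]) simp
      moreover have "p dvd snd z + snd a + iz (fst z) * fst a - v'"
        by (rule dvd_lin2[OF z(3) that(3), where c = 1 and d = 1]) simp
      ultimately show ?thesis unfolding P_def using z(1) by blast
    qed
  next
    fix x v assume "P x v"
    then obtain z where z: "z \<in> S" "p dvd fst z - x" "p dvd snd z + snd a + iz (fst z) * fst a - v"
      unfolding P_def by blast
    \<comment> \<open>One alternation: from \<open>z\<close> along color \<open>a\<close> and back
      along color \<open>b\<close>.\<close>
    obtain z' where z': "z' \<in> S" "factor a z = factor b z'" using z(1) eq by blast
    have "p dvd fst z + fst a + g * iz v * snd a - (fst z + fst a + g * iz v * snd a)" by simp
    then have "factor a z = ((fst z + fst a + g * iz v * snd a) mod p, v mod p)"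
      using z(3) factor_eq_iff by blast
    then have f: "p dvd fst z' + fst b + g * iz v * snd b - (fst z + fst a + g * iz v * snd a)"
      "p dvd snd z' + snd b + iz (fst z') * fst b - v"
      using z'(2) factor_eq_iff by metis+
    let ?x = "x + A + B * g * iz v"
    have x': "p dvd fst z' - ?x"
      by (rule dvd_lin2[OF z(2) f(1), where c = 1 and d = 1]) (simp add: A_def B_def algebra_simps)
    have "iz ?x = iz (fst z')" using iz_cong[OF x'] by simp
    then have "p dvd snd z' + snd a + iz (fst z') * fst a - (v + B + A * iz ?x)"
      by (intro dvd_lin1[OF f(2), where c = 1]) (simp add: A_def B_def algebra_simps)
    then show "P ?x (v + B + A * iz ?x)" unfolding P_def using x' z'(1) by blast
  next
    show "\<not> (p dvd A \<and> p dvd B)" using ab grid_eqI unfolding A_def B_def by blast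
  qed
  then obtain z where z: "z \<in> S" "p dvd fst z" "p dvd snd z + snd a + fst a"
    unfolding P_def by auto
  have "p dvd snd z - (- fst a - snd a) mod p"
    by (rule dvd_lin2[OF z(3) dvd_minus_mod[of p "- fst a - snd a"], where c = 1 and d = 1])
      (simp add: algebra_simps)
  then have "z = (0, (- fst a - snd a) mod p)"
    using z S p_pos by (intro grid_eqI) (auto simp: grid_iff)
  then show ?thesis using z(1) by simp
qed

text \<open>The complement of \<open>S\<close> is closed as well, and both would contain the same
  base point.\<close>

lemma factor_pair_hamiltonian:
  assumes ab: "a \<in> grid" "b \<in> grid" "a \<noteq> b" and S: "S \<subseteq> grid" "S \<noteq> {}"
    and eq: "factor a ` S = factor b ` S"
  shows "S = grid"
proof (rule ccontr)
  assume "S \<noteq> grid"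
  then have "grid - S \<noteq> {}" using S by blast
  moreover have "factor c ` (grid - S) = grid - factor c ` S" for c
    using bij_factor[of c] S inj_on_image_set_diff[of "factor c" grid grid S]
    by (simp add: bij_betw_def)
  ultimately have "(0, (- fst a - snd a) mod p) \<in> grid - S"
    using factor_pair_base_point[OF ab, of "grid - S"] eq by auto
  then show False using factor_pair_base_point[OF ab S eq] by blast
qed

text \<open>
  Relative to its fixed point, the \<open>k\<close>-th iterate has first coordinate \<open>g ^ k * (\<xi> + k * q)\<close>. If
  \<open>q\<close> is nonzero, this takes every value at multiples \<open>k\<close> of \<open>p - 1\<close>; otherwise it takes every nonzero
  value as \<open>g\<close> is a primitive root, so the orbit meets at least one of the lines \<open>x = 0, 1\<close>.
\<close>

lemma affine_orbit:
  fixes P :: "int \<Rightarrow> int \<Rightarrow> bool"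
  assumes per: "\<And>x y x' y'. P x y \<Longrightarrow> p dvd x - x' \<Longrightarrow> p dvd y - y' \<Longrightarrow> P x' y'"
    and step: "\<And>x y. P x y \<Longrightarrow> P (2 * g * x - g\<^sup>2 * y - i) (x - j)"
    and avoid: "\<And>x y. P x y \<Longrightarrow> \<not> p dvd x \<and> \<not> p dvd x - 1"
    and no_fix: "\<And>x y. P x y \<Longrightarrow> p dvd 2 * g * x - g\<^sup>2 * y - i - x \<Longrightarrow> p dvd x - j - y \<Longrightarrow> False"
  shows "\<not> P x y"
proof
  assume Pxy: "P x y"
  have "\<not> p dvd (g - 1)\<^sup>2" using g_facts(2) dvd_mult_iff by (simp add: power2_eq_square)
  \<comment> \<open>\<open>(X, X - j)\<close> is the fixed point of the affine step.\<close>
  then obtain X :: nat where "p dvd (i - g\<^sup>2 * j) + int X * (g - 1)\<^sup>2" using solve_mod by metis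
  then have X: "p dvd (g - 1)\<^sup>2 * X - (g\<^sup>2 * j - i)" by (simp add: algebra_simps)
  \<comment> \<open>In one step \<open>q\<close> becomes \<open>g * q\<close> and the deviation
    \<open>\<xi>\<close> becomes \<open>g * (\<xi> + q)\<close>. This is a Jordan block, which
    explains the factor linear in \<open>k\<close> below.\<close>
  define \<xi> q where "\<xi> = x - int X" and "q = (x - int X) - g * (y - (int X - j))"
  have orbit: "\<exists>\<upsilon>. P (X + g ^ k * (\<xi> + int k * q)) (X - j + \<upsilon>)
      \<and> p dvd g * \<upsilon> - (g ^ k * (\<xi> + int k * q) - g ^ k * q)" for k
  proof (induction k)
    case 0
    show ?case using Pxy by (intro exI[of _ "y - (int X - j)"]) (simp add: \<xi>_def q_def)
  next
    case (Suc k)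
    define s where "s = g ^ k * (\<xi> + int k * q)"
    obtain \<upsilon> where \<upsilon>: "P (X + s) (X - j + \<upsilon>)" "p dvd g * \<upsilon> - (s - g ^ k * q)"
      using Suc.IH unfolding s_def by blast
    have s': "g ^ Suc k * (\<xi> + int (Suc k) * q) = g * s + g ^ Suc k * q"
      by (simp add: s_def algebra_simps)
    have "P (X + (g * s + g ^ Suc k * q)) (X - j + s)"
    proof (rule per[OF step[OF \<upsilon>(1)]])
      show "p dvd 2 * g * (int X + s) - g\<^sup>2 * (int X - j + \<upsilon>) - i - (int X + (g * s + g ^ Suc k * q))"
        by (rule dvd_lin2[OF \<upsilon>(2) X, where c = "- g" and d = "- 1"])
          (simp add: algebra_simps power2_eq_square)
    qed simp
    moreover have "p dvd g * s - ((g * s + g ^ Suc k * q) - g ^ Suc k * q)" by simp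
    ultimately show ?case unfolding s' by blast
  qed
  then have nd: "\<not> p dvd X + g ^ k * (\<xi> + int k * q)" "\<not> p dvd X + g ^ k * (\<xi> + int k * q) - 1" for k
    using avoid by blast+
  show False
  proof (cases "p dvd q")
    case False
    have gp: "p dvd g ^ (nat (p - 1) * m) - 1" for m
    proof -
      have "[nat (g mod p) ^ (nat p - 1) = 1] (mod nat p)"
      proof (rule fermat_theorem)
        show "prime (nat p)" using prime by simp
        have "\<not> p dvd g mod p" using g_facts(1) by (simp add: dvd_mod_iff)
        then show "\<not> nat p dvd nat (g mod p)"
          using p_pos by (metis int_dvd_int_iff int_nat_eq less_imp_le pos_mod_sign)
      qed
      then have "[int (nat (g mod p) ^ (nat p - 1)) = int 1] (mod int (nat p))"
        by (simp only: cong_int_iff)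
      then have "[(g mod p) ^ nat (p - 1) = 1] (mod p)"
        using p_pos by (simp add: nat_diff_distrib')
      then have "[g ^ nat (p - 1) = 1] (mod p)" by (simp add: cong_def power_mod)
      then have "[(g ^ nat (p - 1)) ^ m = 1 ^ m] (mod p)" by (rule cong_pow)
      then show ?thesis by (simp add: power_mult cong_iff_dvd_diff)
    qed
    obtain m :: nat where m: "p dvd (X + \<xi>) + int m * (- q)"
      using solve_mod[of "- q"] False by (metis dvd_minus_iff)
    \<comment> \<open>Here \<open>g ^ k\<close> is 1 by Fermat's theorem and \<open>k\<close> is
      congruent to \<open>- m\<close>, which is why \<open>m\<close> was obtained with
      \<open>- q\<close>.\<close>
    define k where "k = nat (p - 1) * m"
    have k: "int k = (p - 1) * int m" using p_pos by (simp add: k_def)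
    have gk: "p dvd g ^ k - 1" using gp[of m] by (simp add: k_def)
    have "p dvd X + g ^ k * (\<xi> + int k * q)"
      by (rule dvd_lin3[OF m gk dvd_refl[of p], where c = 1 and d = "\<xi> + int k * q" and f = "int m * q"])
        (simp add: k algebra_simps)
    then show False using nd by blast
  next
    case q: True
    show False
    proof (cases "p dvd \<xi>")
      case True
      have "p dvd g * (y - (int X - j))"
        by (rule dvd_lin2[OF True q, where c = 1 and d = "- 1"]) (simp add: \<xi>_def q_def algebra_simps)
      then have y: "p dvd y - (int X - j)" using g_facts dvd_mult_iff by blast
      have x: "p dvd x - int X" using True by (simp add: \<xi>_def)
      have "p dvd 2 * g * x - g\<^sup>2 * y - i - x"
        by (rule dvd_lin3[OF x y X, where c = "2 * g - 1" and d = "- g\<^sup>2" and f = "- 1"])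
          (simp add: algebra_simps power2_eq_square)
      moreover have "p dvd x - j - y"
        by (rule dvd_lin2[OF x y, where c = 1 and d = "- 1"]) simp
      ultimately show False using no_fix Pxy by blast
    next
      case False
      \<comment> \<open>A first coordinate \<open>e\<close> that the orbit never takes must be that
        of the fixed point; otherwise some power of \<open>g\<close> equals
        \<open>(e - X) / \<xi>\<close>. Both 0 and 1 are avoided, and they cannot both be
        \<open>X\<close>.\<close>
      have hit: "p dvd int X - e" if e: "\<And>k. \<not> p dvd X + g ^ k * (\<xi> + int k * q) - e" for e
      proof (rule ccontr)
        assume ne: "\<not> p dvd int X - e"
        obtain b where b: "p dvd \<xi> * b - 1" using inverse_mod[OF False] .
        have "\<not> p dvd b"
        proof
          assume "p dvd b"
          then have "p dvd 1" by (rule dvd_lin2[OF _ b, where c = \<xi> and d = "- 1"]) simp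
          then show False using small_not_dvd[of 1] p_ge by simp
        qed
        then have "\<not> p dvd (e - int X) * b" using ne dvd_mult_iff dvd_diff_commute by metis
        then obtain k where k: "p dvd g ^ k - (e - int X) * b" using gen by blast
        have "p dvd X + g ^ k * (\<xi> + int k * q) - e"
          by (rule dvd_lin3[OF k b q, where c = \<xi> and d = "e - int X" and f = "g ^ k * int k"])
            (simp add: algebra_simps)
        then show False using e by blast
      qed
      have "p dvd int X" using hit[of 0] nd by simp
      moreover have "p dvd int X - 1" using hit[of 1] nd by simp
      ultimately have "p dvd 1" by (rule dvd_lin2[where c = 1 and d = "- 1"]) simp
      then show False using small_not_dvd[of 1] p_ge by simp
    qed
  qed
qed

end

subsection \<open>Breaking the Hamiltonian cycles with two more colors\<close>

text \<open>
  Two colors are added to the \<open>p\<^sup>2\<close> factors. The color \<open>(- 1, 0)\<close> is used on \<open>alpha\<close>, which moves the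
  lines \<open>x = 2, \<dots>, p - 1\<close> by the affine map with double eigenvalue \<open>g\<close>. The factors that do not
  meet \<open>alpha\<close> are those translating by \<open>alpha z - z\<close> with \<open>z\<close> on the lines \<open>x = 0, 1\<close>. The color
  \<open>(- 1, 1)\<close> is used on \<open>beta\<close>, which takes one edge from each of them and maps the lines
  \<open>x = 1, 2\<close> onto \<open>v = w, w'\<close>. The relation between \<open>w\<close> and \<open>w'\<close> excludes the possible cycles of
  length at most four between these lines, and \<open>w' \<noteq> 2\<close> separates \<open>beta\<close> from \<open>alpha\<close>.
\<close>

locale recoloring = primitive_root +
  fixes w w' :: int
  assumes w: "0 < w" "w < p" and w': "0 < w'" "w' < p" "w' \<noteq> 2"
    and ww': "p dvd g\<^sup>2 * (w' - w) + 1"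
begin

text \<open>After one step \<open>y\<close> is \<open>w - j\<close> or \<open>w' - j\<close>, which
  leaves four points on the two lines. Every way to continue from them forces \<open>K\<close> or
  \<open>H\<close> to be both 1 and - 1, or \<open>K\<close> and \<open>H\<close> to vanish
  together, although they differ by the nonzero square of \<open>g - 1\<close>.\<close>

lemma two_lines:
  fixes P :: "int \<Rightarrow> int \<Rightarrow> bool"
  assumes per: "\<And>x y x' y'. P x y \<Longrightarrow> p dvd x - x' \<Longrightarrow> p dvd y - y' \<Longrightarrow> P x' y'"
    and lines: "\<And>x y. P x y \<Longrightarrow> p dvd x - 1 \<or> p dvd x - 2"
    and step1: "\<And>x y. P x y \<Longrightarrow> p dvd x - 1 \<Longrightarrow> P (1 - g\<^sup>2 * (y - w) - i) (w - j)"
    and step2: "\<And>x y. P x y \<Longrightarrow> p dvd x - 2 \<Longrightarrow> P (1 + 2 * g - g\<^sup>2 * (y - w' + 1) - i) (w' - j)"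
    and no_fix1: "\<And>x y. P x y \<Longrightarrow> p dvd x - 1 \<Longrightarrow> p dvd (1 - g\<^sup>2 * (y - w) - i) - x \<Longrightarrow>
        p dvd (w - j) - y \<Longrightarrow> False"
    and no_fix2: "\<And>x y. P x y \<Longrightarrow> p dvd x - 2 \<Longrightarrow> p dvd (1 + 2 * g - g\<^sup>2 * (y - w' + 1) - i) - x \<Longrightarrow>
        p dvd (w' - j) - y \<Longrightarrow> False"
  shows "\<not> P x y"
proof -
  \<comment> \<open>These are the shifts of the first coordinate at \<open>(1, w - j)\<close> and
    \<open>(2, w' - j)\<close>. They vanish exactly if \<open>beta\<close> and the translation by
    \<open>(i, j)\<close> share the edge there.\<close>
  define K H where "K = g\<^sup>2 * j - i" and "H = K - (g - 1)\<^sup>2"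
  have KH: "\<not> p dvd K - H" using g_facts(2) dvd_mult_iff by (simp add: H_def power2_eq_square)
  have nd: "\<not> p dvd 1" "\<not> p dvd 2" using small_not_dvd p_ge by simp_all
  have a: "P 2 (w - j) \<and> p dvd K - 1" if "P 1 (w - j)"
  proof -
    from step1[OF that] have s: "P (1 + K) (w - j)" by (simp add: K_def algebra_simps)
    have "\<not> p dvd K" using no_fix1[OF that] by (auto simp: K_def algebra_simps)
    then have "p dvd K - 1" using lines[OF s] by simp
    then show ?thesis using per[OF s, of 2 "w - j"] by simp
  qed
  \<comment> \<open>With the other second coordinate, the relation \<open>ww'\<close> adds 1 to the
    shift here and subtracts 1 in \<open>d\<close>.\<close>
  have b: "(P 1 (w - j) \<and> p dvd K + 1) \<or> (P 2 (w - j) \<and> p dvd K)" if "P 1 (w' - j)"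
  proof -
    from step1[OF that] have "P (1 - g\<^sup>2 * ((w' - j) - w) - i) (w - j)" by simp
    then have s: "P (2 + K) (w - j)"
      by (rule per) (rule dvd_lin1[OF ww', where c = "- 1"], simp_all add: K_def algebra_simps)
    have "p dvd (2 + K) - 1 \<or> p dvd (2 + K) - 2" by (rule lines[OF s])
    then show ?thesis using per[OF s, of 1 "w - j"] per[OF s, of 2 "w - j"] by (auto simp: algebra_simps)
  qed
  have c: "P 1 (w' - j) \<and> p dvd H + 1" if "P 2 (w' - j)"
  proof -
    from step2[OF that] have s: "P (2 + H) (w' - j)"
      by (simp add: K_def H_def algebra_simps power2_eq_square)
    have "\<not> p dvd H" using no_fix2[OF that] by (auto simp: K_def H_def algebra_simps power2_eq_square)
    then have "p dvd H + 1" using lines[OF s] by (simp add: algebra_simps)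
    then show ?thesis using per[OF s, of 1 "w' - j"] by (simp add: algebra_simps)
  qed
  have d: "(P 1 (w' - j) \<and> p dvd H) \<or> (P 2 (w' - j) \<and> p dvd H - 1)" if "P 2 (w - j)"
  proof -
    from step2[OF that] have "P (1 + 2 * g - g\<^sup>2 * ((w - j) - w' + 1) - i) (w' - j)" by simp
    then have s: "P (1 + H) (w' - j)"
      by (rule per) (rule dvd_lin1[OF ww', where c = 1],
        simp_all add: K_def H_def algebra_simps power2_eq_square)
    have "p dvd (1 + H) - 1 \<or> p dvd (1 + H) - 2" by (rule lines[OF s])
    then show ?thesis using per[OF s, of 1 "w' - j"] per[OF s, of 2 "w' - j"] by (auto simp: algebra_simps)
  qed
  have "\<not> (P 2 (w' - j) \<and> p dvd H - 1)"
  proof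
    assume h: "P 2 (w' - j) \<and> p dvd H - 1"
    with c have "p dvd H + 1" by blast
    with h have "p dvd 2" using dvd_lin2[of p "H + 1" "H - 1" 2 1 "- 1"] by simp
    then show False using nd by simp
  qed
  with d have d': "P 1 (w' - j) \<and> p dvd H" if "P 2 (w - j)" using that by blast
  have "\<not> (P 1 (w - j) \<and> p dvd K + 1)"
  proof
    assume h: "P 1 (w - j) \<and> p dvd K + 1"
    with a have "p dvd K - 1" by blast
    with h have "p dvd 2" using dvd_lin2[of p "K + 1" "K - 1" 2 1 "- 1"] by simp
    then show False using nd by simp
  qed
  with b have b': "P 2 (w - j) \<and> p dvd K" if "P 1 (w' - j)" using that by blast
  have nb: "\<not> P 1 (w' - j)"
  proof
    assume "P 1 (w' - j)"
    with b' d' have "p dvd K" "p dvd H" by blast+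
    then show False using KH by simp
  qed
  then have no: "\<not> P 1 (w - j)" "\<not> P 2 (w' - j)" "\<not> P 2 (w - j)" using a c d' by blast+
  show ?thesis
  proof
    assume P: "P x y"
    obtain x' y' where P': "P x' y'" "y' = w - j \<or> y' = w' - j"
      using lines[OF P] step1[OF P] step2[OF P] by blast
    have "P 1 y' \<or> P 2 y'" using lines[OF P'(1)] per[OF P'(1)] by auto
    then show False using P'(2) no nb by blast
  qed
qed

text \<open>It moves \<open>(x, y)\<close> by \<open>(i, j)\<close> exactly if
  \<open>j = x - y\<close> and \<open>i = g\<^sup>2 * j - (g - 1)\<^sup>2 * x\<close>. Hence every
  translation agrees with the affine map in one point, whose \<open>x\<close> is determined by
  \<open>i\<close> and \<open>j\<close>.\<close>

definition alpha :: "int \<times> int \<Rightarrow> int \<times> int" where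
  "alpha z = ((2 * g * fst z - g\<^sup>2 * snd z) mod p, fst z mod p)"

text \<open>The points of x = 1 and x = 2 are moved by the vectors \<open>(g\<^sup>2 * j, j)\<close>
  and \<open>(g\<^sup>2 * j - (g - 1)\<^sup>2, j)\<close>, which are those of the affine map on x =
  0 and x = 1.\<close>

definition beta :: "int \<times> int \<Rightarrow> int \<times> int" where
  "beta z = (if fst z = 1 then ((1 - g\<^sup>2 * (snd z - w)) mod p, w mod p)
    else ((1 + 2 * g - g\<^sup>2 * (snd z - w' + 1)) mod p, w' mod p))"

definition dom_alpha :: "(int \<times> int) set" where "dom_alpha = {z \<in> grid. 2 \<le> fst z}"

definition dom_beta :: "(int \<times> int) set" where "dom_beta = {z \<in> grid. fst z = 1 \<or> fst z = 2}"

lemma not_dvd_w: "\<not> p dvd w" "\<not> p dvd w'" "\<not> p dvd w' - w" "\<not> p dvd w' - 2"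
proof -
  show "\<not> p dvd w" "\<not> p dvd w'" "\<not> p dvd w' - 2"
    using w w' p_ge by (intro small_not_dvd; simp)+
  show "\<not> p dvd w' - w"
  proof
    assume "p dvd w' - w"
    then have "p dvd 1" by (rule dvd_lin2[OF ww', where c = 1 and d = "- g\<^sup>2"]) simp
    then show False using small_not_dvd[of 1] p_ge by simp
  qed
qed

lemma inj_alpha: "inj_on alpha grid"
proof (rule inj_onI)
  fix z z' assume z: "z \<in> grid" "z' \<in> grid" "alpha z = alpha z'"
  then have d: "p dvd (2 * g * fst z - g\<^sup>2 * snd z) - (2 * g * fst z' - g\<^sup>2 * snd z')"
    "p dvd fst z - fst z'"
    unfolding alpha_def mod_pair_eq_iff by blast+
  have "p dvd (g * g) * (snd z - snd z')"
    by (rule dvd_lin2[OF d, where c = "- 1" and d = "2 * g"]) (simp add: algebra_simps power2_eq_square)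
  then have "p dvd snd z - snd z'" using g_facts dvd_mult_iff by blast
  then show "z = z'" using z d grid_eqI by blast
qed

lemma inj_beta: "inj_on beta dom_beta"
proof (rule inj_onI)
  fix z z' assume z: "z \<in> dom_beta" "z' \<in> dom_beta" "beta z = beta z'"
  have f: "fst z = fst z'"
    using z not_dvd_w(3) dvd_diff_commute[of p w w']
    by (auto simp: beta_def dom_beta_def mod_eq_dvd_iff split: if_splits)
  have "p dvd (g * g) * (snd z - snd z')"
  proof (cases "fst z = 1")
    case True
    then have "p dvd (1 - g\<^sup>2 * (snd z - w)) - (1 - g\<^sup>2 * (snd z' - w))"
      using z f by (simp add: beta_def mod_eq_dvd_iff)
    then show ?thesis by (rule dvd_lin1[where c = "- 1"]) (simp add: algebra_simps power2_eq_square)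
  next
    case False
    then have "p dvd (1 + 2 * g - g\<^sup>2 * (snd z - w' + 1)) - (1 + 2 * g - g\<^sup>2 * (snd z' - w' + 1))"
      using z f by (simp add: beta_def mod_eq_dvd_iff)
    then show ?thesis by (rule dvd_lin1[where c = "- 1"]) (simp add: algebra_simps power2_eq_square)
  qed
  then have "p dvd snd z - snd z'" using g_facts dvd_mult_iff by blast
  then show "z = z'" using z f by (intro grid_eqI) (auto simp: dom_beta_def)
qed

text \<open>The number \<open>x\<close> is where the affine map agrees with the translation by
  \<open>a\<close>. For 0 and 1 it is outside the domain of \<open>alpha\<close>, and
  \<open>beta\<close> has an edge with the same vector on the line \<open>x + 1\<close>.\<close>

lemma factor_meets_recolored:
  assumes a: "a \<in> grid"
  shows "\<exists>z\<in>grid. (z \<in> dom_alpha \<and> factor a z = alpha z) \<or> (z \<in> dom_beta \<and> factor a z = beta z)"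
proof -
  obtain i j where ij: "a = (i, j)" by (cases a)
  have "\<not> p dvd (g - 1)\<^sup>2" using g_facts(2) dvd_mult_iff by (simp add: power2_eq_square)
  then obtain n :: nat where n: "int n < p" "p dvd (i - g\<^sup>2 * j) + int n * (g - 1)\<^sup>2"
    using solve_mod by metis
  define x where "x = int n"
  have x: "0 \<le> x" "x < p" "p dvd (i - g\<^sup>2 * j) + x * (g - 1)\<^sup>2" using n by (simp_all add: x_def)
  consider "x = 0" | "x = 1" | "2 \<le> x" using x(1) by linarith
  then show ?thesis
  proof cases
    case 1
    define z where "z = (1::int, (w - j) mod p)"
    have m: "p dvd (w - j) mod p - (w - j)" by (metis dvd_diff_commute dvd_minus_mod)
    have z: "z \<in> grid" using p_ge by (simp add: z_def grid_iff)
    have iz1: "iz 1 = 0" using small_not_dvd[of 1] p_ge by simp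
    have "factor a z = beta z"
    proof -
      have "factor a z = ((1 - g\<^sup>2 * (snd z - w)) mod p, w mod p)"
        unfolding factor_eq_iff
      proof
        show "p dvd fst z + fst a + g * iz w * snd a - (1 - g\<^sup>2 * (snd z - w))"
          by (rule dvd_lin2[OF m x(3), where c = "g\<^sup>2" and d = 1])
            (simp add: 1 z_def ij not_dvd_w algebra_simps)
        show "p dvd snd z + snd a + iz (fst z) * fst a - w"
          by (rule dvd_lin1[OF m, where c = 1]) (simp add: z_def ij iz1)
      qed
      then show ?thesis by (simp add: beta_def z_def)
    qed
    then show ?thesis using z by (intro bexI[of _ z]) (auto simp: dom_beta_def z_def)
  next
    case 2
    define z where "z = (2::int, (w' - j) mod p)"
    have m: "p dvd (w' - j) mod p - (w' - j)" by (metis dvd_diff_commute dvd_minus_mod)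
    have z: "z \<in> grid" using p_ge by (simp add: z_def grid_iff)
    have iz1: "iz 2 = 0" using small_not_dvd[of 2] p_ge by simp
    have "factor a z = beta z"
    proof -
      have "factor a z = ((1 + 2 * g - g\<^sup>2 * (snd z - w' + 1)) mod p, w' mod p)"
        unfolding factor_eq_iff
      proof
        show "p dvd fst z + fst a + g * iz w' * snd a - (1 + 2 * g - g\<^sup>2 * (snd z - w' + 1))"
          by (rule dvd_lin2[OF m x(3), where c = "g\<^sup>2" and d = 1])
            (simp add: 2 z_def ij not_dvd_w algebra_simps power2_eq_square)
        show "p dvd snd z + snd a + iz (fst z) * fst a - w'"
          by (rule dvd_lin1[OF m, where c = 1]) (simp add: z_def ij iz1)
      qed
      then show ?thesis by (simp add: beta_def z_def)
    qed
    then show ?thesis using z by (intro bexI[of _ z]) (auto simp: dom_beta_def z_def)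
  next
    case 3
    define z where "z = (x, (x - j) mod p)"
    have m: "p dvd (x - j) mod p - (x - j)" by (metis dvd_diff_commute dvd_minus_mod)
    have z: "z \<in> grid" using p_ge x by (simp add: z_def grid_iff)
    have izx: "iz x = 0" using small_not_dvd[of x] 3 x by simp
    have "factor a z = alpha z"
      unfolding alpha_def factor_eq_iff
    proof
      show "p dvd fst z + fst a + g * iz (fst z) * snd a - (2 * g * fst z - g\<^sup>2 * snd z)"
        by (rule dvd_lin2[OF m x(3), where c = "g\<^sup>2" and d = 1])
          (simp add: z_def ij izx algebra_simps power2_eq_square)
      show "p dvd snd z + snd a + iz (fst z) * fst a - fst z"
        by (rule dvd_lin1[OF m, where c = 1]) (simp add: z_def ij izx)
    qed
    then show ?thesis using z 3 by (intro bexI[of _ z]) (auto simp: dom_alpha_def z_def)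
  qed
qed

lemma factor_translation:
  assumes "factor a z = (u mod p, v mod p)" "\<not> p dvd fst z" "\<not> p dvd v"
  shows "p dvd fst z - (u - fst a)" "p dvd snd z - (v - snd a)"
  using assms(1) unfolding factor_eq_iff by (simp_all add: assms algebra_simps)

text \<open>The second coordinate of \<open>alpha z\<close> is \<open>fst z\<close> and thus
  nonzero, so color \<open>a\<close> acts on \<open>S\<close> as a translation and an alternation is
  the step of \<open>affine_orbit\<close>. A fixed point would be an edge common to both
  matchings.\<close>

lemma alpha_factor_no_cycle:
  assumes S: "S \<subseteq> dom_alpha" "S \<noteq> {}" and ne: "\<And>z. z \<in> S \<Longrightarrow> factor a z \<noteq> alpha z"
    and eq: "factor a ` S = alpha ` S"
  shows False
proof -
  define P where "P x y \<longleftrightarrow> (\<exists>z\<in>S. p dvd fst z - x \<and> p dvd snd z - y)" for x y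
  have nz: "\<not> p dvd fst z" "\<not> p dvd fst z - 1" if "z \<in> S" for z
  proof -
    have "2 \<le> fst z" "fst z < p" using subsetD[OF S(1) that] by (simp_all add: dom_alpha_def grid_iff)
    then show "\<not> p dvd fst z" "\<not> p dvd fst z - 1" by (intro small_not_dvd; simp)+
  qed
  have "\<not> P x y" for x y
  proof (rule affine_orbit[where P = P and i = "fst a" and j = "snd a"])
    fix x y x' y' assume h: "P x y" "p dvd x - x'" "p dvd y - y'"
    then obtain z where z: "z \<in> S" "p dvd fst z - x" "p dvd snd z - y" unfolding P_def by blast
    have "p dvd fst z - x'" by (rule dvd_lin2[OF z(2) h(2), where c = 1 and d = 1]) simp
    moreover have "p dvd snd z - y'" by (rule dvd_lin2[OF z(3) h(3), where c = 1 and d = 1]) simp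
    ultimately show "P x' y'" unfolding P_def using z by blast
  next
    fix x y assume "P x y"
    then obtain z where z: "z \<in> S" "p dvd fst z - x" "p dvd snd z - y" unfolding P_def by blast
    obtain z' where z': "z' \<in> S" "factor a z' = alpha z" using z(1) eq by (metis imageE imageI)
    note t = factor_translation[OF z'(2)[unfolded alpha_def] nz(1)[OF z'(1)] nz(1)[OF z(1)]]
    have "p dvd fst z' - (2 * g * x - g\<^sup>2 * y - fst a)"
      by (rule dvd_lin3[OF t(1) z(2,3), where c = 1 and d = "2 * g" and f = "- g\<^sup>2"])
        (simp add: algebra_simps)
    moreover have "p dvd snd z' - (x - snd a)"
      by (rule dvd_lin2[OF t(2) z(2), where c = 1 and d = 1]) simp
    ultimately show "P (2 * g * x - g\<^sup>2 * y - fst a) (x - snd a)" unfolding P_def using z'(1) by blast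
  next
    fix x y assume "P x y"
    then obtain z where z: "z \<in> S" "p dvd fst z - x" unfolding P_def by blast
    then show "\<not> p dvd x \<and> \<not> p dvd x - 1"
      using nz[OF z(1)] dvd_lin2[of p "fst z - x" x "fst z" 1 1]
        dvd_lin2[of p "fst z - x" "x - 1" "fst z - 1" 1 1] by auto
  next
    fix x y assume h: "P x y" "p dvd 2 * g * x - g\<^sup>2 * y - fst a - x" "p dvd x - snd a - y"
    then obtain z where z: "z \<in> S" "p dvd fst z - x" "p dvd snd z - y" unfolding P_def by blast
    have "factor a z = alpha z"
      unfolding alpha_def factor_eq_iff
    proof
      show "p dvd fst z + fst a + g * iz (fst z) * snd a - (2 * g * fst z - g\<^sup>2 * snd z)"
        by (rule dvd_lin3[OF h(2) z(2,3), where c = "- 1" and d = "1 - 2 * g" and f = "g\<^sup>2"])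
          (simp add: nz[OF z(1)] algebra_simps)
      show "p dvd snd z + snd a + iz (fst z) * fst a - fst z"
        by (rule dvd_lin3[OF h(3) z(2,3), where c = "- 1" and d = "- 1" and f = 1])
          (simp add: nz[OF z(1)] algebra_simps)
    qed
    then show False using ne z(1) by blast
  qed
  moreover obtain z where "z \<in> S" using S by blast
  then have "P (fst z) (snd z)" unfolding P_def by force
  ultimately show False by blast
qed

lemma beta_factor_no_cycle:
  assumes S: "S \<subseteq> dom_beta" "S \<noteq> {}" and ne: "\<And>z. z \<in> S \<Longrightarrow> factor a z \<noteq> beta z"
    and eq: "factor a ` S = beta ` S"
  shows False
proof -
  define P where "P x y \<longleftrightarrow> (\<exists>z\<in>S. p dvd fst z - x \<and> p dvd snd z - y)" for x y
  have nd: "\<not> p dvd 1" "\<not> p dvd 2" using small_not_dvd p_ge by simp_all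
  have nz: "\<not> p dvd fst z" if "z \<in> S" for z
    using that S(1) nd by (auto simp: dom_beta_def)
  have fst1: "fst z = 1" if "z \<in> S" "p dvd fst z - x" "p dvd x - 1" for z x
  proof -
    have "p dvd fst z - 1" by (rule dvd_lin2[OF that(2,3), where c = 1 and d = 1]) simp
    then show ?thesis using that(1) S(1) nd by (auto simp: dom_beta_def)
  qed
  have fst2: "fst z = 2" if "z \<in> S" "p dvd fst z - x" "p dvd x - 2" for z x
  proof -
    have "p dvd fst z - 2" by (rule dvd_lin2[OF that(2,3), where c = 1 and d = 1]) simp
    then show ?thesis using that(1) S(1) nd by (auto simp: dom_beta_def)
  qed
  have "\<not> P x y" for x y
  proof (rule two_lines[where P = P and i = "fst a" and j = "snd a"])
    fix x y x' y' assume h: "P x y" "p dvd x - x'" "p dvd y - y'"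
    then obtain z where z: "z \<in> S" "p dvd fst z - x" "p dvd snd z - y" unfolding P_def by blast
    have "p dvd fst z - x'" by (rule dvd_lin2[OF z(2) h(2), where c = 1 and d = 1]) simp
    moreover have "p dvd snd z - y'" by (rule dvd_lin2[OF z(3) h(3), where c = 1 and d = 1]) simp
    ultimately show "P x' y'" unfolding P_def using z by blast
  next
    fix x y assume "P x y"
    then obtain z where z: "z \<in> S" "p dvd fst z - x" unfolding P_def by blast
    then have "fst z = 1 \<or> fst z = 2" using S(1) by (auto simp: dom_beta_def)
    then show "p dvd x - 1 \<or> p dvd x - 2" using z(2) by (metis dvd_diff_commute)
  next
    fix x y assume "P x y" and x: "p dvd x - 1"
    then obtain z where z: "z \<in> S" "p dvd fst z - x" "p dvd snd z - y" unfolding P_def by blast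
    obtain z' where z': "z' \<in> S" "factor a z' = beta z" using z(1) eq by (metis imageE imageI)
    have "beta z = ((1 - g\<^sup>2 * (snd z - w)) mod p, w mod p)" using fst1[OF z(1,2) x] by (simp add: beta_def)
    note t = factor_translation[OF z'(2)[unfolded this] nz[OF z'(1)] not_dvd_w(1)]
    have "p dvd fst z' - (1 - g\<^sup>2 * (y - w) - fst a)"
      by (rule dvd_lin2[OF t(1) z(3), where c = 1 and d = "- g\<^sup>2"]) (simp add: algebra_simps)
    then show "P (1 - g\<^sup>2 * (y - w) - fst a) (w - snd a)" unfolding P_def using z'(1) t(2) by blast
  next
    fix x y assume "P x y" and x: "p dvd x - 2"
    then obtain z where z: "z \<in> S" "p dvd fst z - x" "p dvd snd z - y" unfolding P_def by blast
    obtain z' where z': "z' \<in> S" "factor a z' = beta z" using z(1) eq by (metis imageE imageI)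
    have "beta z = ((1 + 2 * g - g\<^sup>2 * (snd z - w' + 1)) mod p, w' mod p)"
      using fst2[OF z(1,2) x] by (simp add: beta_def)
    note t = factor_translation[OF z'(2)[unfolded this] nz[OF z'(1)] not_dvd_w(2)]
    have "p dvd fst z' - (1 + 2 * g - g\<^sup>2 * (y - w' + 1) - fst a)"
      by (rule dvd_lin2[OF t(1) z(3), where c = 1 and d = "- g\<^sup>2"]) (simp add: algebra_simps)
    then show "P (1 + 2 * g - g\<^sup>2 * (y - w' + 1) - fst a) (w' - snd a)"
      unfolding P_def using z'(1) t(2) by blast
  next
    fix x y assume h: "P x y" "p dvd x - 1" "p dvd (1 - g\<^sup>2 * (y - w) - fst a) - x"
      "p dvd (w - snd a) - y"
    then obtain z where z: "z \<in> S" "p dvd fst z - x" "p dvd snd z - y" unfolding P_def by blast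
    have "factor a z = ((1 - g\<^sup>2 * (snd z - w)) mod p, w mod p)"
      unfolding factor_eq_iff
    proof
      show "p dvd fst z + fst a + g * iz w * snd a - (1 - g\<^sup>2 * (snd z - w))"
        by (rule dvd_lin3[OF h(3) z(2,3), where c = "- 1" and d = 1 and f = "g\<^sup>2"])
          (simp add: not_dvd_w algebra_simps)
      show "p dvd snd z + snd a + iz (fst z) * fst a - w"
        by (rule dvd_lin2[OF h(4) z(3), where c = "- 1" and d = 1]) (simp add: nz[OF z(1)])
    qed
    then have "factor a z = beta z" using fst1[OF z(1,2) h(2)] by (simp add: beta_def)
    then show False using ne z(1) by blast
  next
    fix x y assume h: "P x y" "p dvd x - 2" "p dvd (1 + 2 * g - g\<^sup>2 * (y - w' + 1) - fst a) - x"
      "p dvd (w' - snd a) - y"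
    then obtain z where z: "z \<in> S" "p dvd fst z - x" "p dvd snd z - y" unfolding P_def by blast
    have "factor a z = ((1 + 2 * g - g\<^sup>2 * (snd z - w' + 1)) mod p, w' mod p)"
      unfolding factor_eq_iff
    proof
      show "p dvd fst z + fst a + g * iz w' * snd a - (1 + 2 * g - g\<^sup>2 * (snd z - w' + 1))"
        by (rule dvd_lin3[OF h(3) z(2,3), where c = "- 1" and d = 1 and f = "g\<^sup>2"])
          (simp add: not_dvd_w algebra_simps)
      show "p dvd snd z + snd a + iz (fst z) * fst a - w'"
        by (rule dvd_lin2[OF h(4) z(3), where c = "- 1" and d = 1]) (simp add: nz[OF z(1)])
    qed
    then have "factor a z = beta z" using fst2[OF z(1,2) h(2)] by (simp add: beta_def)
    then show False using ne z(1) by blast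
  qed
  moreover obtain z where "z \<in> S" using S by blast
  then have "P (fst z) (snd z)" unfolding P_def by force
  ultimately show False by blast
qed

text \<open>The domains meet only in x = 2, where the images have second coordinates 2 and
  \<open>w'\<close>.\<close>

lemma alpha_beta_no_cycle:
  assumes "S \<subseteq> dom_alpha" "S \<subseteq> dom_beta" "S \<noteq> {}" "alpha ` S = beta ` S"
  shows False
proof -
  have two: "fst z = 2" if "z \<in> S" for z
    using subsetD[OF assms(1) that] subsetD[OF assms(2) that] by (auto simp: dom_alpha_def dom_beta_def)
  obtain z where z: "z \<in> S" using assms by blast
  then obtain z' where "z' \<in> S" "alpha z = beta z'" using assms(4) by (metis imageE imageI)
  then have "2 mod p = w' mod p" using two z by (simp add: alpha_def beta_def)
  then show False using not_dvd_w(4) dvd_diff_commute[of p 2 w'] by (simp add: mod_eq_dvd_iff)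
qed

text \<open>The first coordinate - 1 keeps the two new colors outside \<open>grid\<close>.\<close>

definition color :: "int \<times> int \<Rightarrow> int \<times> int \<Rightarrow> int \<times> int" where
  "color z t = (if z \<in> dom_alpha \<and> t = alpha z then (- 1, 0)
    else if z \<in> dom_beta \<and> t = beta z then (- 1, 1)
    else (THE a. a \<in> grid \<and> factor a z = t))"

lemma color_cases:
  assumes "z \<in> grid" "t \<in> grid"
  obtains (alpha) "z \<in> dom_alpha" "t = alpha z" "color z t = (- 1, 0)"
  | (beta) "z \<in> dom_beta" "t = beta z" "color z t = (- 1, 1)"
  | (factor) "color z t \<in> grid" "factor (color z t) z = t"
      "\<not> (z \<in> dom_alpha \<and> t = alpha z)" "\<not> (z \<in> dom_beta \<and> t = beta z)"
proof -
  have "t \<in> (\<lambda>a. factor a z) ` grid"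
    using bij_betw_imp_surj_on[OF bij_factor_color[OF assms(1)]] assms(2) by simp
  then obtain a where a: "a \<in> grid" "factor a z = t" by blast
  have "(THE a. a \<in> grid \<and> factor a z = t) = a"
  proof (rule the_equality)
    show "b = a" if "b \<in> grid \<and> factor b z = t" for b
      using inj_onD[OF bij_betw_imp_inj_on[OF bij_factor_color[OF assms(1)]], of b a] that a by simp
  qed (use a in blast)
  then have the: "color z t = a" if "\<not> (z \<in> dom_alpha \<and> t = alpha z)" "\<not> (z \<in> dom_beta \<and> t = beta z)"
    using that by (simp only: color_def if_False)
  consider (1) "z \<in> dom_alpha \<and> t = alpha z" | (2) "\<not> (z \<in> dom_alpha \<and> t = alpha z)" "z \<in> dom_beta \<and> t = beta z"
    | (3) "\<not> (z \<in> dom_alpha \<and> t = alpha z)" "\<not> (z \<in> dom_beta \<and> t = beta z)"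
    by blast
  then show thesis
  proof cases
    case 1
    then have "color z t = (- 1, 0)" by (simp add: color_def)
    then show thesis using 1 that(1) by blast
  next
    case 2
    then have "color z t = (- 1, 1)" by (simp only: color_def if_False if_True simp_thms)
    then show thesis using 2 that(2) by blast
  next
    case 3
    show thesis by (rule that(3)) (simp_all only: the[OF 3] a 3 simp_thms)
  qed
qed

lemma special_not_grid: "(- 1, x) \<notin> grid"
  by (simp add: grid_iff)

lemma colorD:
  assumes "z \<in> grid" "t \<in> grid"
  shows "color z t = (- 1, 0) \<Longrightarrow> z \<in> dom_alpha \<and> t = alpha z"
    and "color z t = (- 1, 1) \<Longrightarrow> z \<in> dom_beta \<and> t = beta z"
    and "color z t \<in> grid \<Longrightarrow>
      factor (color z t) z = t \<and> \<not> (z \<in> dom_alpha \<and> t = alpha z) \<and> \<not> (z \<in> dom_beta \<and> t = beta z)"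
    and "color z t \<in> insert (- 1, 0) (insert (- 1, 1) grid)"
proof -
  note cases = color_cases[OF assms]
  show "color z t = (- 1, 0) \<Longrightarrow> z \<in> dom_alpha \<and> t = alpha z"
    by (rule cases) (auto simp: special_not_grid)
  show "color z t = (- 1, 1) \<Longrightarrow> z \<in> dom_beta \<and> t = beta z"
    by (rule cases) (auto simp: special_not_grid)
  show "factor (color z t) z = t \<and> \<not> (z \<in> dom_alpha \<and> t = alpha z) \<and> \<not> (z \<in> dom_beta \<and> t = beta z)"
    if "color z t \<in> grid"
    using that by - (rule cases, simp_all add: special_not_grid)
  show "color z t \<in> insert (- 1, 0) (insert (- 1, 1) grid)"
    by (rule cases) simp_all
qed

text \<open>Two factors would need all of \<open>grid\<close>, where color \<open>a\<close> has lost
  an edge. Against a new color, \<open>S\<close> lies in its domain and contains no shared edge, as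
  that edge has been recolored. The last assumption fixes the order of the two colors; the other
  order follows by exchanging \<open>f\<close> and \<open>h\<close>.\<close>

lemma color_no_cycle:
  assumes S: "S \<subseteq> grid" "S \<noteq> {}" "f ` S \<subseteq> grid" "h ` S = f ` S" and ab: "a \<noteq> b"
    and f: "\<And>z. z \<in> S \<Longrightarrow> color z (f z) = a" and h: "\<And>z. z \<in> S \<Longrightarrow> color z (h z) = b"
    and a: "a \<in> grid \<or> a = (- 1, 0) \<and> b \<notin> grid"
  shows False
proof -
  have g: "z \<in> grid" "f z \<in> grid" "h z \<in> grid" if "z \<in> S" for z
    using that S by blast+
  have b: "b \<in> grid \<or> b = (- 1, 0) \<or> b = (- 1, 1)"
    using S(2) colorD(4)[OF g(1,3)] h by (metis ex_in_conv insertE)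
  have bA: "S \<subseteq> dom_alpha \<and> h ` S = alpha ` S" if "b = (- 1, 0)"
    using colorD(1)[OF g(1,3)] h that by (metis image_cong subsetI)
  have bB: "S \<subseteq> dom_beta \<and> h ` S = beta ` S" if "b = (- 1, 1)"
    using colorD(2)[OF g(1,3)] h that by (metis image_cong subsetI)
  show False
  proof (cases "a \<in> grid")
    case True
    then have fa: "factor a z = f z" "\<not> (z \<in> dom_alpha \<and> f z = alpha z)" "\<not> (z \<in> dom_beta \<and> f z = beta z)"
      if "z \<in> S" for z
      using colorD(3)[OF g(1)[OF that] g(2)[OF that]] f[OF that] True by auto
    then have fS: "f ` S = factor a ` S" by (metis image_cong)
    from b consider "b \<in> grid" | "b = (- 1, 0)" | "b = (- 1, 1)" by blast
    then show False
    proof cases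
      case 1
      then have "h ` S = factor b ` S" using colorD(3)[OF g(1,3)] h by (metis image_cong)
      then have "S = grid" using factor_pair_hamiltonian[OF True 1 ab S(1,2)] fS S(4) by simp
      then show False using factor_meets_recolored[OF True] fa by metis
    next
      case 2
      then show False using alpha_factor_no_cycle[of S a] bA S fa fS by (metis subsetD)
    next
      case 3
      then show False using beta_factor_no_cycle[of S a] bB S fa fS by (metis subsetD)
    qed
  next
    case False
    then have aA: "a = (- 1, 0)" "b = (- 1, 1)" using a b ab by auto
    then have "S \<subseteq> dom_alpha" "f ` S = alpha ` S"
      using colorD(1)[OF g(1,2)] f by (metis subsetI, metis image_cong)
    then show False using alpha_beta_no_cycle[of S] bB[OF aA(2)] S by simp
  qed
qed

lemma acyclic_array_color: "acyclic_array grid grid color"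
proof (rule acyclic_arrayI)
  show "inj_on (color z) grid" if z: "z \<in> grid" for z
  proof (rule inj_onI)
    fix t t' assume "t \<in> grid" "t' \<in> grid" "color z t = color z t'"
    then show "t = t'"
      using colorD[OF z \<open>t \<in> grid\<close>] colorD[OF z \<open>t' \<in> grid\<close>] by auto
  qed
  show "inj_on (\<lambda>z. color z t) grid" if t: "t \<in> grid" for t
  proof (rule inj_onI)
    fix z z' assume z: "z \<in> grid" "z' \<in> grid" and eq: "color z t = color z' t"
    note D = colorD[OF z(1) t] and D' = colorD[OF z(2) t]
    consider "color z t = (- 1, 0)" | "color z t = (- 1, 1)" | "color z t \<in> grid"
      using D(4) by blast
    then show "z = z'"
    proof cases
      case 1
      then show ?thesis using D(1) D'(1) eq z inj_alpha by (metis inj_onD)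
    next
      case 2
      then show ?thesis using D(2) D'(2) eq z inj_beta by (metis inj_onD)
    next
      case 3
      then show ?thesis using D(3) D'(3) eq z bij_factor by (metis bij_betw_imp_inj_on inj_onD)
    qed
  qed
  show "a = b"
    if S: "S \<subseteq> grid" "S \<noteq> {}" "f ` S \<subseteq> grid" "h ` S = f ` S"
      and c: "\<And>z. z \<in> S \<Longrightarrow> color z (f z) = a" "\<And>z. z \<in> S \<Longrightarrow> color z (h z) = b"
    for S f h a b
  proof (rule ccontr)
    assume ab: "a \<noteq> b"
    obtain z where z: "z \<in> S" using S by blast
    then have g: "z \<in> grid" "f z \<in> grid" "h z \<in> grid" using S by blast+
    have "a \<in> insert (- 1, 0) (insert (- 1, 1) grid)" "b \<in> insert (- 1, 0) (insert (- 1, 1) grid)"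
      using colorD(4)[OF g(1,2)] colorD(4)[OF g(1,3)] c[OF z] by simp_all
    then have "(a \<in> grid \<or> a = (- 1, 0) \<and> b \<notin> grid) \<or> (b \<in> grid \<or> b = (- 1, 0) \<and> a \<notin> grid)"
      using ab special_not_grid by auto
    then show False
    proof
      assume "a \<in> grid \<or> a = (- 1, 0) \<and> b \<notin> grid"
      then show False using color_no_cycle[OF S ab c] by blast
    next
      assume "b \<in> grid \<or> b = (- 1, 0) \<and> a \<notin> grid"
      moreover have "h ` S \<subseteq> grid" "f ` S = h ` S" "b \<noteq> a" using S ab by auto
      ultimately show False using color_no_cycle[OF S(1,2), of h f b a] c by blast
    qed
  qed
qed

end

text \<open>With \<open>c\<close> inverse to \<open>g\<^sup>2\<close>, the relation means
  \<open>w' = w - c\<close>. Then w = 0, w' = 0 and w' = 2 exclude the residues 0, \<open>c\<close>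
  and \<open>c + 2\<close> for \<open>w\<close>.\<close>

lemma (in primitive_root) ex_recoloring: "\<exists>w w'. recoloring p g w w'"
proof -
  have "\<not> p dvd g\<^sup>2" using g_facts dvd_mult_iff by (simp add: power2_eq_square)
  then obtain c where c: "p dvd g\<^sup>2 * c - 1" using inverse_mod by blast
  have "\<not> {0..<p} \<subseteq> {0, c mod p, (c + 2) mod p}"
  proof
    assume "{0..<p} \<subseteq> {0, c mod p, (c + 2) mod p}"
    then have "card {0..<p} \<le> card {0, c mod p, (c + 2) mod p}" by (intro card_mono) auto
    also have "\<dots> \<le> 3" by (simp add: card_insert_if)
    finally show False using p_ge by simp
  qed
  then obtain w where "w \<in> {0..<p}" "w \<notin> {0, c mod p, (c + 2) mod p}" by blast
  then have w: "0 \<le> w" "w < p" "w \<noteq> 0" "w \<noteq> c mod p" "w \<noteq> (c + 2) mod p" by auto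
  define w' where "w' = (w - c) mod p"
  have m: "p dvd w' - (w - c)" unfolding w'_def by (metis dvd_diff_commute dvd_minus_mod)
  have "w' \<noteq> 0"
  proof
    assume "w' = 0"
    then have "w mod p = c mod p" using m by (simp add: mod_eq_dvd_iff dvd_diff_commute)
    then show False using w by simp
  qed
  moreover have "w' \<noteq> 2"
  proof
    assume "w' = 2"
    then have "p dvd w - (c + 2)" using m by (intro dvd_lin1[OF m, where c = "- 1"]) simp
    then have "w mod p = (c + 2) mod p" by (simp add: mod_eq_dvd_iff)
    then show False using w by simp
  qed
  moreover have "0 \<le> w'" "w' < p" using p_pos by (simp_all add: w'_def)
  moreover have "p dvd g\<^sup>2 * (w' - w) + 1"
    by (rule dvd_lin2[OF m c, where c = "g\<^sup>2" and d = "- 1"]) (simp add: algebra_simps)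
  ultimately have "recoloring p g w w'" using w by unfold_locales auto
  then show ?thesis by blast
qed

section \<open>Transfer from the grid to arbitrary vertex classes\<close>

lemma ex_acyclic_array:
  fixes p :: nat
  assumes p: "prime p" "5 \<le> p" and U: "finite U" "card U = p\<^sup>2" and V: "finite V" "card V = p\<^sup>2"
  shows "\<exists>C :: 'x \<Rightarrow> 'y \<Rightarrow> nat. acyclic_array U V C \<and> (\<forall>u\<in>U. \<forall>v\<in>V. C u v < p\<^sup>2 + 2)"
proof -
  have "2 < p" using p by simp
  obtain g where "\<And>a. \<not> int p dvd a \<Longrightarrow> \<exists>k. int p dvd g ^ k - a" "\<And>r. \<not> int p dvd r\<^sup>2 - g"
    using ex_primitive_root_nonsquare[OF p(1) \<open>2 < p\<close>] by metis
  then interpret primitive_root "int p" g using p by unfold_locales auto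
  obtain w w' where "recoloring (int p) g w w'" using ex_recoloring by blast
  then interpret recoloring "int p" g w w' .
  have card_grid: "card grid = p\<^sup>2" by (simp add: grid_def card_cartesian_product power2_eq_square)
  obtain \<phi> where \<phi>: "bij_betw \<phi> U grid"
    using finite_same_card_bij[OF U(1) finite_grid] U(2) card_grid by auto
  obtain \<psi> where \<psi>: "bij_betw \<psi> V grid"
    using finite_same_card_bij[OF V(1) finite_grid] V(2) card_grid by auto
  define Q where "Q = insert (- 1, 0) (insert (- 1, 1) grid)"
  have "finite Q" "card Q = p\<^sup>2 + 2"
    using finite_grid card_grid special_not_grid by (simp_all add: Q_def)
  then obtain e where e: "bij_betw e Q {0..<p\<^sup>2 + 2}" using ex_bij_betw_finite_nat by metis
  define C where "C u v = e (color (\<phi> u) (\<psi> v))" for u v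
  have \<phi>U: "\<phi> u \<in> grid" if "u \<in> U" for u using \<phi> that by (rule bij_betwE[THEN bspec])
  have \<psi>V: "\<psi> v \<in> grid" if "v \<in> V" for v using \<psi> that by (rule bij_betwE[THEN bspec])
  have colQ: "color (\<phi> u) (\<psi> v) \<in> Q" if "u \<in> U" "v \<in> V" for u v
    using colorD(4)[OF \<phi>U[OF that(1)] \<psi>V[OF that(2)]] by (simp add: Q_def)
  have C_eq: "C u v = C u' v' \<longleftrightarrow> color (\<phi> u) (\<psi> v) = color (\<phi> u') (\<psi> v')"
    if "u \<in> U" "v \<in> V" "u' \<in> U" "v' \<in> V" for u v u' v'
    unfolding C_def using e colQ that by (auto simp: bij_betw_def inj_on_eq_iff)
  have \<phi>inj: "\<phi> u = \<phi> u' \<longleftrightarrow> u = u'" if "u \<in> U" "u' \<in> U" for u u'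
    using \<phi> that by (auto simp: bij_betw_def inj_on_eq_iff)
  have \<psi>inj: "\<psi> v = \<psi> v' \<longleftrightarrow> v = v'" if "v \<in> V" "v' \<in> V" for v v'
    using \<psi> that by (auto simp: bij_betw_def inj_on_eq_iff)
  have row: "inj_on (color z) grid" if "z \<in> grid" for z
    using acyclic_array_color that unfolding acyclic_array_def by blast
  have column: "inj_on (\<lambda>z. color z t) grid" if "t \<in> grid" for t
    using acyclic_array_color that unfolding acyclic_array_def by blast
  have "acyclic_array U V C"
  proof (rule acyclic_arrayI)
    show "inj_on (C u) V" if "u \<in> U" for u
      using row[OF \<phi>U[OF that]] that by (intro inj_onI) (metis C_eq \<psi>V \<psi>inj inj_onD)
    show "inj_on (\<lambda>u. C u v) U" if "v \<in> V" for v
      using column[OF \<psi>V[OF that]] that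
      by (intro inj_onI) (metis (mono_tags, lifting) C_eq \<phi>U \<phi>inj inj_onD)
    show "a = b"
      if S: "S \<subseteq> U" "S \<noteq> {}" "f ` S \<subseteq> V" "h ` S = f ` S"
        and c: "\<And>u. u \<in> S \<Longrightarrow> C u (f u) = a" "\<And>u. u \<in> S \<Longrightarrow> C u (h u) = b" for S f h a b
    proof -
      obtain s where s: "s \<in> S" using S by blast
      define \<theta> where "\<theta> = inv_into U \<phi>"
      have \<theta>: "\<theta> (\<phi> u) = u" if "u \<in> S" for u
        using \<phi> that S unfolding \<theta>_def by (meson bij_betw_inv_into_left subsetD)
      have mem: "u \<in> U" "f u \<in> V" "h u \<in> V" if "u \<in> S" for u using that S by blast+
      \<comment> \<open>\<open>e\<close> is injective only on \<open>Q\<close>, so the two colors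
        are represented by those at one point \<open>s\<close> instead of by preimages of
        \<open>a\<close> and \<open>b\<close>.\<close>
      have "color (\<phi> s) (\<psi> (f s)) = color (\<phi> s) (\<psi> (h s))"
      proof (rule acyclic_arrayD[OF acyclic_array_color])
        show "\<phi> ` S \<subseteq> grid" "\<phi> ` S \<noteq> {}" using \<phi>U S by auto
        show "(\<lambda>z. \<psi> (f (\<theta> z))) ` \<phi> ` S \<subseteq> grid" using \<theta> \<psi>V mem by auto
        have "(\<lambda>z. \<psi> (k (\<theta> z))) ` \<phi> ` S = \<psi> ` k ` S" for k
          unfolding image_image using \<theta> by (intro image_cong) auto
        then show "(\<lambda>z. \<psi> (h (\<theta> z))) ` \<phi> ` S = (\<lambda>z. \<psi> (f (\<theta> z))) ` \<phi> ` S"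
          using S by simp
      next
        fix z assume "z \<in> \<phi> ` S"
        then obtain u where u: "u \<in> S" "z = \<phi> u" by blast
        have "C u (f u) = C s (f s)" "C u (h u) = C s (h s)" using c u(1) s by simp_all
        then show "color z (\<psi> (f (\<theta> z))) = color (\<phi> s) (\<psi> (f s))"
          "color z (\<psi> (h (\<theta> z))) = color (\<phi> s) (\<psi> (h s))"
          using u s \<theta> mem C_eq by simp_all
      qed
      then have "C s (f s) = C s (h s)" using C_eq mem s by simp
      then show "a = b" using c s by simp
    qed
  qed
  moreover have "\<forall>u\<in>U. \<forall>v\<in>V. C u v < p\<^sup>2 + 2"
    using e colQ unfolding C_def bij_betw_def by auto
  ultimately show ?thesis by blast
qed

subsection \<open>The acyclic chromatic index\<close>

context complete_bipartite
begin

lemma finite_parts: "finite U" "finite V"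
  using finite_verts verts_eq by simp_all

lemma vertex_degree_left: "u \<in> U \<Longrightarrow> vertex_degree G u = card V"
proof -
  assume u: "u \<in> U"
  have "{e \<in> edges G. u \<in> e} = (\<lambda>v. {u, v}) ` V"
    using u disj by (auto simp: edges_eq)
  moreover have "inj_on (\<lambda>v. {u, v}) V" by (auto simp: inj_on_def doubleton_eq_iff)
  ultimately show ?thesis by (simp add: vertex_degree_def card_image)
qed

lemma vertex_degree_right: "v \<in> V \<Longrightarrow> vertex_degree G v = card U"
proof -
  assume v: "v \<in> V"
  have "{e \<in> edges G. v \<in> e} = (\<lambda>u. {u, v}) ` U"
    using v disj by (auto simp: edges_eq)
  moreover have "inj_on (\<lambda>u. {u, v}) U" by (auto simp: inj_on_def doubleton_eq_iff)
  ultimately show ?thesis by (simp add: vertex_degree_def card_image)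
qed

lemma max_degree_eq:
  assumes "card U = n" "card V = n" "0 < n"
  shows "max_degree G = n"
proof -
  have "vertex_degree G ` verts G = {n}"
    using assms vertex_degree_left vertex_degree_right card_gt_0_iff[of U]
    unfolding verts_eq by (auto simp: image_Un)
  then show ?thesis by (simp add: max_degree_def)
qed

lemma acyclic_edge_colorable_if_acyclic_array:
  assumes C: "acyclic_array U V C" "\<And>u v. u \<in> U \<Longrightarrow> v \<in> V \<Longrightarrow> C u v < k"
  shows "acyclic_edge_colorable G k"
proof -
  \<comment> \<open>Edges are unordered; disjointness of the sides tells their two ends
    apart.\<close>
  define c where "c e = C (THE u. u \<in> e \<inter> U) (THE v. v \<in> e \<inter> V)" for e
  have c: "c {u, v} = C u v" if "u \<in> U" "v \<in> V" for u v
  proof -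
    have "{u, v} \<inter> U = {u}" "{u, v} \<inter> V = {v}" using that disj by auto
    then show ?thesis by (simp add: c_def)
  qed
  have "acyclic_array U V (\<lambda>u v. c {u, v})"
  proof (rule acyclic_arrayI)
    show "inj_on (\<lambda>v. c {u, v}) V" if "u \<in> U" for u
      using C(1) c that by (simp add: acyclic_array_def cong: inj_on_cong)
    show "inj_on (\<lambda>u. c {u, v}) U" if "v \<in> V" for v
      using C(1) c that by (simp add: acyclic_array_def cong: inj_on_cong)
    show "a = b"
      if S: "S \<subseteq> U" "S \<noteq> {}" "f ` S \<subseteq> V" "h ` S = f ` S"
        and ab: "\<And>u. u \<in> S \<Longrightarrow> c {u, f u} = a" "\<And>u. u \<in> S \<Longrightarrow> c {u, h u} = b" for S f h a b
    proof (rule acyclic_arrayD[OF C(1) S])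
      fix u assume u: "u \<in> S"
      then have "u \<in> U" "f u \<in> V" "h u \<in> V" using S by blast+
      then show "C u (f u) = a" "C u (h u) = b" using ab[OF u] c by simp_all
    qed
  qed
  then have "acyclic_edge_coloring G c" by (rule acyclic_edge_coloring_if_acyclic_array)
  moreover have "c ` edges G \<subseteq> {..<k}" using C(2) c by (auto simp: edges_eq)
  ultimately show ?thesis unfolding acyclic_edge_colorable_def by blast
qed

text \<open>Bounding \<open>k\<close> from above, rather than fixing it to \<open>n + 1\<close>,
  yields minimality directly.\<close>

lemma not_acyclic_edge_colorable_Suc:
  assumes "card U = n" "card V = n" "odd n" "1 < n" "k \<le> n + 1"
  shows "\<not> acyclic_edge_colorable G k"
proof
  assume "acyclic_edge_colorable G k"
  then obtain c :: "'a set \<Rightarrow> nat" where c: "c ` edges G \<subseteq> {..<k}" "acyclic_edge_coloring G c"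
    unfolding acyclic_edge_colorable_def by blast
  have "c {u, v} \<le> n" if "u \<in> U" "v \<in> V" for u v
  proof -
    have "{u, v} \<in> edges G" using that by (simp add: edge_iff)
    then have "c {u, v} < k" using c(1) by blast
    then show ?thesis using assms(5) by simp
  qed
  then have "\<not> acyclic_array U V (\<lambda>u v. c {u, v})"
    using assms by (intro not_acyclic_array_Suc_colors[OF finite_parts])
  then show False using acyclic_array_if_acyclic_edge_coloring[OF finite_parts(1) c(2)] by blast
qed

end

theorem theorem2:
  fixes p :: nat and G :: "('a, 'b) pre_digraph"
  assumes "prime p" and "odd p" and "p \<ge> 5"
    and "K\<^bsub>p\<^sup>2,p\<^sup>2\<^esub> G"
  shows "acyclic_chromatic_index G = p\<^sup>2 + 2
    \<and> p\<^sup>2 + 2 = max_degree G + 2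
    \<and> max_degree G = p\<^sup>2"
proof -
  have "graph G" using assms(4) by (simp add: complete_bipartite_digraph_def)
  then interpret graph G .
  obtain U V where UV: "verts G = U \<union> V" "U \<inter> V = {}" "card U = p\<^sup>2" "card V = p\<^sup>2"
    "arcs_ends G = U \<times> V \<union> V \<times> U"
    using assms(4) unfolding complete_bipartite_digraph_def by blast
  interpret complete_bipartite G U V by unfold_locales (use UV in auto)
  obtain C :: "'a \<Rightarrow> 'a \<Rightarrow> nat" where "acyclic_array U V C" "\<forall>u\<in>U. \<forall>v\<in>V. C u v < p\<^sup>2 + 2"
    using ex_acyclic_array[OF assms(1,3) finite_parts(1) UV(3) finite_parts(2) UV(4)] by blast
  then have upper: "acyclic_edge_colorable G (p\<^sup>2 + 2)"
    by (intro acyclic_edge_colorable_if_acyclic_array) auto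
  have "1 < p" using assms(3) by simp
  then have p2: "1 < p\<^sup>2" "odd (p\<^sup>2)" using assms(2) one_less_power[of p 2] by simp_all
  have "acyclic_chromatic_index G = p\<^sup>2 + 2"
    unfolding acyclic_chromatic_index_def
  proof (rule Least_equality[of "acyclic_edge_colorable G", OF upper])
    fix k assume "acyclic_edge_colorable G k"
    then show "p\<^sup>2 + 2 \<le> k"
      using not_acyclic_edge_colorable_Suc[OF UV(3,4) p2(2,1), of k] by linarith
  qed
  moreover have "max_degree G = p\<^sup>2" using \<open>1 < p\<close> by (intro max_degree_eq[OF UV(3,4)]) simp
  ultimately show ?thesis by simp
qed

end
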